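(* Let $k\ge1$ be an integer and let $f(u)=u^{2k}+f_{2k}(u)$, where $f_{2k}:\mathbb{R}\to\mathbb{R}$ is of class $C^{2k}$ and $\lim_{s\to0}f_{2k}(s)/|s|^{2k}=0$. There exists a small $\epsilon=\epsilon(k;f_{2k})>0$ such that the following holds. If $$u\in C(\mathbb{R}:H^{4,2}(\mathbb{R}))\cap L^\infty(\mathbb{R}:H^1(\mathbb{R}))$$ is a non-trivial (i.e. not identically zero) real-valued strong solution of $$\partial_t u+\partial_x(\partial_x^2u+f(u))=0,\qquad (t,x)\in\mathbb{R}\times\mathbb{R},$$ with $$\sup_{t\in\mathbb{R}}\|u(t)\|_{H^1}<\epsilon,$$ then $u=u(t,x)$ is not a time periodic solution (i.e. there is no $\omega>0$ with $u(t+\omega,x)=u(t,x)$ for all $t,x$).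
   Context: For $s,r\ge 0$, $H^{s,r}(\mathbb{R}):=H^s(\mathbb{R})\cap L^2(|x|^{2r}dx)$. "Strong solution" of the initial value problem (with $u(0,\cdot)=u_0$) has its standard meaning: $u$ is a continuous function of time with values in the stated space and satisfies the equation with this initial datum. *)

theory Defs
  imports "HOL-Analysis.Analysis"
begin

text \<open>Elements of \<open>L\<^sup>2(\<real>)\<close> and of the Sobolev spaces are represented by Lebesgue measurable
  functions \<open>real \<Rightarrow> real\<close>. All notions below are invariant under changes on null sets, and equality
  of two elements is equality almost everywhere.\<close>

definition C_times :: "nat \<Rightarrow> (real \<Rightarrow> real) \<Rightarrow> bool" where
  "C_times n f \<longleftrightarrow>
     (\<forall>j<n. \<forall>x. (deriv ^^ j) f field_differentiable (at x)) \<and> continuous_on UNIV ((deriv ^^ n) f)"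

definition test_function :: "(real \<Rightarrow> real) \<Rightarrow> bool" where
  "test_function \<phi> \<longleftrightarrow> (\<forall>n. C_times n \<phi>) \<and> compact (closure {x. \<phi> x \<noteq> 0})"

definition locally_integrable :: "(real \<Rightarrow> real) \<Rightarrow> bool" where
  "locally_integrable f \<longleftrightarrow> (\<forall>a b. set_integrable lebesgue {a..b} f)"

definition has_weak_deriv :: "nat \<Rightarrow> (real \<Rightarrow> real) \<Rightarrow> (real \<Rightarrow> real) \<Rightarrow> bool" where
  "has_weak_deriv j f g \<longleftrightarrow> locally_integrable f \<and> locally_integrable g \<and>
     (\<forall>\<phi>. test_function \<phi> \<longrightarrow>
        (LINT x|lebesgue. f x * (deriv ^^ j) \<phi> x) = (-1) ^ j * (LINT x|lebesgue. g x * \<phi> x))"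

text \<open>Weak derivatives are unique up to null sets, so the choice below does not affect the norms.\<close>

definition weak_deriv :: "nat \<Rightarrow> (real \<Rightarrow> real) \<Rightarrow> real \<Rightarrow> real" where
  "weak_deriv j f = (SOME g. has_weak_deriv j f g)"

text \<open>\<open>weighted_L2 r\<close> is \<open>L\<^sup>2(|x|\<^bsup>2r\<^esup> dx)\<close>. For \<open>r = 0\<close> the weight is \<open>1\<close> except at the
  single point \<open>x = 0\<close>, where \<open>0 powr 0 = 0\<close>.\<close>

definition weighted_L2 :: "real \<Rightarrow> (real \<Rightarrow> real) set" where
  "weighted_L2 r = {f. f \<in> borel_measurable lebesgue \<and>
                       integrable lebesgue (\<lambda>x. (f x)\<^sup>2 * \<bar>x\<bar> powr (2 * r))}"

definition weighted_L2_norm :: "real \<Rightarrow> (real \<Rightarrow> real) \<Rightarrow> real" where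
  "weighted_L2_norm r f = sqrt (LINT x|lebesgue. (f x)\<^sup>2 * \<bar>x\<bar> powr (2 * r))"

definition L2 :: "(real \<Rightarrow> real) set" where
  "L2 = {f. f \<in> borel_measurable lebesgue \<and> integrable lebesgue (\<lambda>x. (f x)\<^sup>2)}"

definition L2_norm :: "(real \<Rightarrow> real) \<Rightarrow> real" where
  "L2_norm f = sqrt (LINT x|lebesgue. (f x)\<^sup>2)"

definition sobolev :: "nat \<Rightarrow> (real \<Rightarrow> real) set" where
  "sobolev s = {f \<in> L2. \<forall>j\<le>s. \<exists>g\<in>L2. has_weak_deriv j f g}"

definition sobolev_norm :: "nat \<Rightarrow> (real \<Rightarrow> real) \<Rightarrow> real" where
  "sobolev_norm s f = sqrt (\<Sum>j\<le>s. (L2_norm (weak_deriv j f))\<^sup>2)"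

definition weighted_sobolev :: "nat \<Rightarrow> real \<Rightarrow> (real \<Rightarrow> real) set" where
  "weighted_sobolev s r = sobolev s \<inter> weighted_L2 r"

definition weighted_sobolev_norm :: "nat \<Rightarrow> real \<Rightarrow> (real \<Rightarrow> real) \<Rightarrow> real" where
  "weighted_sobolev_norm s r f = sqrt ((sobolev_norm s f)\<^sup>2 + (weighted_L2_norm r f)\<^sup>2)"

text \<open>A function of \<open>(t, x)\<close> is given as a curve \<open>u\<close>, with \<open>u t\<close> the function of \<open>x\<close> at time \<open>t\<close>.\<close>

definition continuous_curves :: "nat \<Rightarrow> real \<Rightarrow> (real \<Rightarrow> real \<Rightarrow> real) set" where
  "continuous_curves s r = {u. (\<forall>t. u t \<in> weighted_sobolev s r) \<and>
     (\<forall>t. ((\<lambda>t'. weighted_sobolev_norm s r (\<lambda>x. u t' x - u t x)) \<longlongrightarrow> 0) (at t))}"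

text \<open>The space \<open>L\<^sup>\<infinity>(\<real> : H\<^sup>s(\<real>))\<close>. Since \<open>H\<^sup>s(\<real>)\<close> is separable, (strong) measurability of \<open>u\<close>
  amounts to measurability of all distance functions \<open>t \<mapsto> \<parallel>u(t) - v\<parallel>\<close>.\<close>

definition Linf_curves :: "nat \<Rightarrow> (real \<Rightarrow> real \<Rightarrow> real) set" where
  "Linf_curves s = {u. (\<forall>t. u t \<in> sobolev s) \<and>
     (\<forall>v\<in>sobolev s. (\<lambda>t. sobolev_norm s (\<lambda>x. u t x - v x)) \<in> borel_measurable lebesgue) \<and>
     (\<exists>M. AE t in lebesgue. sobolev_norm s (u t) \<le> M)}"

definition has_L2_time_deriv :: "(real \<Rightarrow> real \<Rightarrow> real) \<Rightarrow> (real \<Rightarrow> real) \<Rightarrow> real \<Rightarrow> bool" where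
  "has_L2_time_deriv u w t \<longleftrightarrow> (\<forall>t'. u t' \<in> L2) \<and> w \<in> L2 \<and>
     ((\<lambda>h. L2_norm (\<lambda>x. (u (t + h) x - u t x) / h - w x)) \<longlongrightarrow> 0) (at 0)"

text \<open>A strong solution of \<open>\<partial>\<^sub>t u + \<partial>\<^sub>x(\<partial>\<^sub>x\<^sup>2 u + f(u)) = 0\<close> with values in \<open>H\<^bsup>s,r\<^esup>\<close> (its initial
  datum being \<open>u 0\<close>): \<open>\<partial>\<^sub>t u\<close> is the derivative of the curve in \<open>L\<^sup>2(\<real>)\<close>, the \<open>x\<close>-derivatives are
  weak derivatives, and the equation holds in \<open>L\<^sup>2(\<real>)\<close> at every time.\<close>

definition strong_solution ::
  "nat \<Rightarrow> real \<Rightarrow> (real \<Rightarrow> real) \<Rightarrow> (real \<Rightarrow> real \<Rightarrow> real) \<Rightarrow> bool" where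
  "strong_solution s r f u \<longleftrightarrow> u \<in> continuous_curves s r \<and>
     (\<forall>t. \<exists>u\<^sub>t u\<^sub>x\<^sub>x F\<^sub>x. has_L2_time_deriv u u\<^sub>t t \<and> has_weak_deriv 2 (u t) u\<^sub>x\<^sub>x \<and>
        has_weak_deriv 1 (\<lambda>x. u\<^sub>x\<^sub>x x + f (u t x)) F\<^sub>x \<and> (AE x in lebesgue. u\<^sub>t x + F\<^sub>x x = 0))"

end

theory Submission
  imports Defs "HOL-Computational_Algebra.Polynomial"
begin

text \<open>Formally \<open>d/dt \<integral> x u dx = \<integral> f(u) dx\<close>. By the embedding of \<open>H\<^sup>1\<close> in \<open>L\<^sup>\<infinity>\<close>, smallness of \<open>u\<close> gives
  \<open>u\<^bsup>2k\<^esup>/2 \<le> f(u) \<le> 2u\<^sup>2\<close>, so this moment strictly increases while \<open>u\<close> does not vanish. To avoid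
  convergence questions for the moment, \<open>x\<close> is replaced by \<open>\<phi>\<^sub>N(x) = N \<psi>(x/N)\<close> with \<open>\<psi>\<close> smooth, compactly
  supported and equal to \<open>x\<close> near \<open>0\<close>. Then \<open>d/dt \<integral> u \<phi>\<^sub>N = \<integral> u \<phi>\<^sub>N''' + \<integral> f(u) \<phi>\<^sub>N'\<close> has integral zero
  over a period, the first term is \<open>O(1/N)\<close>, and dominated convergence shows that \<open>\<integral> f(u)\<close> has integral zero
  over every period. Hence \<open>u(t) = 0\<close> for almost every \<open>t\<close>, and for every \<open>t\<close> by continuity of
  \<open>t \<mapsto> \<integral> u(t) \<rho>\<close> for test functions \<open>\<rho>\<close>.\<close>

subsection \<open>Smooth functions of compact support\<close>

text \<open>A class of smooth functions that contains \<open>exp(-1/x)\<close> and whose closure under differentiation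
  follows from a single induction over its rules.\<close>

inductive_set smooth :: "(real \<Rightarrow> real) set" where
  flat: "(\<lambda>x. if x > 0 then poly p (1 / x) * exp (- (1 / x)) else 0) \<in> smooth"
| const: "(\<lambda>x. c) \<in> smooth"
| ident: "(\<lambda>x. x) \<in> smooth"
| add: "f \<in> smooth \<Longrightarrow> g \<in> smooth \<Longrightarrow> (\<lambda>x. f x + g x) \<in> smooth"
| mult: "f \<in> smooth \<Longrightarrow> g \<in> smooth \<Longrightarrow> (\<lambda>x. f x * g x) \<in> smooth"
| affine: "f \<in> smooth \<Longrightarrow> (\<lambda>x. f (a * x + b)) \<in> smooth"
| antideriv: "f \<in> smooth \<Longrightarrow> (\<And>x. (F has_real_derivative f x) (at x)) \<Longrightarrow> F \<in> smooth"

section \<open>Differentiation inside the class \<open>smooth\<close>\<close>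

lemma poly_mult_exp_minus_tendsto_0:
  fixes p :: "real poly"
  shows "((\<lambda>z. poly p z * exp (- z)) \<longlongrightarrow> 0) at_top"
proof -
  have "((\<lambda>z. \<Sum>i\<le>degree p. coeff p i * (z ^ i / exp z)) \<longlongrightarrow> (\<Sum>i\<le>degree p. coeff p i * 0)) at_top"
    by (intro tendsto_sum tendsto_mult tendsto_const tendsto_power_div_exp_0)
  moreover have "(\<Sum>i\<le>degree p. coeff p i * (z ^ i / exp z)) = poly p z * exp (- z)" for z
    by (simp add: poly_altdef exp_minus sum_distrib_right divide_inverse mult.assoc)
  ultimately show ?thesis by simp
qed

text \<open>With \<open>z = 1/x\<close> the chain rule turns \<open>p(z) exp(-z)\<close> into
  \<open>z^2 (p - p')(z) exp(-z)\<close>, which is where \<open>q\<close> comes from. At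
  \<open>0\<close> exponential decay in \<open>z\<close> beats every polynomial.\<close>

lemma flat_has_derivative:
  fixes p :: "real poly"
  defines "q \<equiv> [:0, 0, 1:] * (p - pderiv p)"
  shows "((\<lambda>x. if x > 0 then poly p (1 / x) * exp (- (1 / x)) else 0) has_real_derivative
          (if x > 0 then poly q (1 / x) * exp (- (1 / x)) else 0)) (at x)"
    (is "(?f has_real_derivative _) _")
proof -
  consider "x > 0" | "x < 0" | "x = 0" by linarith
  then show ?thesis
  proof cases
    case 1
    have ev: "\<forall>\<^sub>F y in nhds x. ?f y = poly p (1 / y) * exp (- (1 / y))"
      using eventually_nhds_in_open[of "{0<..}" x] 1 by (auto elim!: eventually_mono)
    have "((\<lambda>y. poly p (1 / y) * exp (- (1 / y))) has_real_derivative
            poly q (1 / x) * exp (- (1 / x))) (at x)"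
      unfolding q_def using 1
      by (auto intro!: derivative_eq_intros DERIV_chain2[OF poly_DERIV] simp: field_simps power2_eq_square)
    then show ?thesis
      using DERIV_cong_ev[OF refl ev refl] 1 by simp
  next
    case 2
    have ev: "\<forall>\<^sub>F y in nhds x. ?f y = 0"
      using eventually_nhds_in_open[of "{..<0}" x] 2 by (auto elim!: eventually_mono)
    show ?thesis
      using DERIV_cong_ev[OF refl ev refl] 2 by simp
  next
    case 3
    \<comment> \<open>The difference quotient at \<open>0\<close> from the right is
      \<open>z p(z) exp(-z)\<close> with \<open>z = 1/y\<close>; the division by \<open>y\<close>
      supplies the factor \<open>[:0, 1:]\<close>.\<close>
    have "((\<lambda>z. poly (p * [:0, 1:]) z * exp (- z)) \<longlongrightarrow> 0) at_top"
      by (rule poly_mult_exp_minus_tendsto_0)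
    then have "((\<lambda>y::real. poly (p * [:0, 1:]) (inverse y) * exp (- inverse y)) \<longlongrightarrow> 0) (at_right 0)"
      by (rule filterlim_compose) (rule filterlim_inverse_at_top_right)
    then have "((\<lambda>y. ?f y / y) \<longlongrightarrow> 0) (at_right 0)"
      by (rule Lim_transform_eventually)
        (auto simp: eventually_at_filter field_simps)
    moreover have "((\<lambda>y. ?f y / y) \<longlongrightarrow> 0) (at_left 0)"
      by (rule Lim_transform_eventually[OF tendsto_const]) (auto simp: eventually_at_filter)
    ultimately have "((\<lambda>y. ?f y / y) \<longlongrightarrow> 0) (at 0)"
      by (rule filterlim_split_at[rotated])
    then show ?thesis
      using 3 by (simp add: has_field_derivative_iff)
  qed
qed

lemma smooth_derivE:
  assumes "f \<in> smooth"
  obtains f' where "f' \<in> smooth" "\<And>x. (f has_real_derivative f' x) (at x)"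
proof -
  have "\<exists>f'\<in>smooth. \<forall>x. (f has_real_derivative f' x) (at x)"
    using assms
  proof induction
    case (flat p)
    show ?case by (rule bexI[OF allI smooth.flat]) (rule flat_has_derivative)
  next
    case (const c)
    show ?case by (rule bexI[OF _ smooth.const[of 0]]) auto
  next
    case ident
    show ?case by (rule bexI[OF _ smooth.const[of 1]]) auto
  next
    case (add f g)
    then obtain f' g' where *: "f' \<in> smooth" "\<forall>x. (f has_real_derivative f' x) (at x)"
      "g' \<in> smooth" "\<forall>x. (g has_real_derivative g' x) (at x)" by blast
    show ?case
      by (rule bexI[OF _ smooth.add[OF *(1,3)]]) (use * in \<open>auto intro!: derivative_intros\<close>)
  next
    case (mult f g)
    then obtain f' g' where *: "f' \<in> smooth" "\<forall>x. (f has_real_derivative f' x) (at x)"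
      "g' \<in> smooth" "\<forall>x. (g has_real_derivative g' x) (at x)" by blast
    show ?case
      by (rule bexI[OF _ smooth.add[OF smooth.mult[OF *(1) mult(2)] smooth.mult[OF *(3) mult(1)]]])
        (use * in \<open>auto intro!: derivative_eq_intros\<close>)
  next
    case (affine f a b)
    then obtain f' where *: "f' \<in> smooth" "\<forall>x. (f has_real_derivative f' x) (at x)" by blast
    show ?case
      by (rule bexI[OF _ smooth.mult[OF smooth.affine[OF *(1), of a b] smooth.const[of a]]])
        (use * in \<open>auto intro!: derivative_eq_intros DERIV_chain2[where f = f]\<close>)
  next
    case (antideriv f F)
    then show ?case by blast
  qed
  then show thesis using that by blast
qed

lemma smooth_deriv: "f \<in> smooth \<Longrightarrow> deriv f \<in> smooth"
  by (metis DERIV_imp_deriv ext smooth_derivE)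

lemma smooth_has_deriv: "f \<in> smooth \<Longrightarrow> (f has_real_derivative deriv f x) (at x)"
  by (metis DERIV_imp_deriv smooth_derivE)

lemma smooth_derivs: "f \<in> smooth \<Longrightarrow> (deriv ^^ n) f \<in> smooth"
  by (induction n) (auto intro: smooth_deriv)

lemma smooth_continuous_on: "f \<in> smooth \<Longrightarrow> continuous_on A f"
  by (meson DERIV_isCont continuous_at_imp_continuous_on smooth_has_deriv)

lemma smooth_C_times: "f \<in> smooth \<Longrightarrow> C_times n f"
  unfolding C_times_def field_differentiable_def
  using smooth_has_deriv smooth_continuous_on smooth_derivs by blast

text \<open>Continuity provides some antiderivative and the rule \<open>antideriv\<close> admits it
  to the class. Subtracting its value at \<open>a\<close> fixes the constant.\<close>

lemma smooth_antiderivE: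
  assumes "f \<in> smooth"
  obtains F where "F \<in> smooth" "\<And>x. (F has_real_derivative f x) (at x)" "F a = 0"
proof -
  have "\<And>x. isCont f x"
    using assms smooth_has_deriv DERIV_isCont by blast
  then obtain G where G: "\<And>x. (G has_real_derivative f x) (at x)"
    using einterval_antiderivative[of "-\<infinity>" \<infinity> f]
    by (auto simp: has_real_derivative_iff_has_vector_derivative)
  have F: "((\<lambda>x. G x - G a) has_real_derivative f x) (at x)" for x
    using G by (auto intro!: derivative_eq_intros)
  show thesis
    by (rule that[OF smooth.antideriv[OF assms F] F]) simp
qed

text \<open>The link to weak derivatives: test functions are built inside \<open>smooth\<close>, and
  this lemma makes them admissible in \<open>has_weak_deriv\<close>.\<close>

lemma smooth_test_function:
  assumes "f \<in> smooth" "\<And>x. x \<notin> {a..b} \<Longrightarrow> f x = 0"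
  shows "test_function f"
proof -
  have "{x. f x \<noteq> 0} \<subseteq> {a..b}"
    using assms(2) by blast
  then have "bounded {x. f x \<noteq> 0}"
    using bounded_subset bounded_closed_interval by blast
  then show ?thesis
    using assms(1) by (auto simp: test_function_def smooth_C_times compact_closure)
qed

section \<open>Behaviour outside the support\<close>

lemma deriv_zero_outside:
  fixes f :: "real \<Rightarrow> real"
  assumes "\<And>x. x \<notin> {a..b} \<Longrightarrow> f x = 0" "x \<notin> {a..b}"
  shows "deriv f x = 0"
proof -
  have ev: "\<forall>\<^sub>F y in nhds x. f y = 0"
    using eventually_nhds_in_open[OF open_Compl[OF closed_atLeastAtMost], of x a b] assms(2)
    by (auto elim!: eventually_mono intro: assms(1))
  have "(f has_real_derivative 0) (at x)"
    by (simp add: DERIV_cong_ev[OF refl ev refl])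
  then show ?thesis
    by (rule DERIV_imp_deriv)
qed

lemma derivs_zero_outside:
  fixes f :: "real \<Rightarrow> real"
  assumes "\<And>x. x \<notin> {a..b} \<Longrightarrow> f x = 0" "x \<notin> {a..b}"
  shows "(deriv ^^ n) f x = 0"
  using assms(2)
proof (induction n arbitrary: x)
  case (Suc n)
  then show ?case using deriv_zero_outside[of a b "(deriv ^^ n) f" x] by simp
qed (simp add: assms(1))

lemma constant_outside_support:
  fixes F f :: "real \<Rightarrow> real"
  assumes "\<And>x. (F has_real_derivative f x) (at x)" "\<And>x. x \<notin> {a..b} \<Longrightarrow> f x = 0"
  shows "x \<le> a \<Longrightarrow> F x = F a" "x \<ge> b \<Longrightarrow> F x = F b"
proof -
  have c: "continuous_on S F" for S
    using assms(1) DERIV_isCont continuous_at_imp_continuous_on by blast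
  have const: "F y = F x" if "x < y" "\<And>z. x < z \<Longrightarrow> z < y \<Longrightarrow> z \<notin> {a..b}" for x y
  proof (rule DERIV_isconst_end[OF \<open>x < y\<close> c])
    fix z assume "x < z" "z < y"
    then have "z \<notin> {a..b}" using that(2) by blast
    then show "(F has_real_derivative 0) (at z)"
      using assms(1)[of z] assms(2)[of z] by simp
  qed
  show "F x = F a" if "x \<le> a"
    using const[of x a] that by (cases "x = a") auto
  show "F x = F b" if "x \<ge> b"
    using const[of b x] that by (cases "x = b") auto
qed

text \<open>The product \<open>e(x) e(1 - x)\<close> is a bump on the unit interval; its
  antiderivative from \<open>0\<close>, divided by its total mass \<open>F 1\<close>, is the step.
  Cutoffs and approximations of indicators are assembled from it.\<close>

lemma smooth_stepE:
  obtains \<theta> where "\<theta> \<in> smooth" "\<And>x. x \<le> 0 \<Longrightarrow> \<theta> x = 0" "\<And>x. x \<ge> 1 \<Longrightarrow> \<theta> x = 1"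
    "\<And>x. 0 \<le> \<theta> x" "\<And>x. \<theta> x \<le> 1" "\<And>x. x \<notin> {0..1} \<Longrightarrow> deriv \<theta> x = 0"
proof -
  define e :: "real \<Rightarrow> real" where "e x = (if x > 0 then exp (- (1 / x)) else 0)" for x
  define h where "h x = e x * e (1 - x)" for x
  \<comment> \<open>This is the rule \<open>flat\<close> for the constant polynomial
    \<open>1\<close>.\<close>
  have e: "e \<in> smooth"
    using smooth.flat[of 1] by (simp add: e_def[abs_def] cong: if_cong)
  have h: "h \<in> smooth"
    unfolding h_def[abs_def] using smooth.mult[OF e smooth.affine[OF e, of "-1" 1]] by simp
  have h0: "h x = 0" if "x \<notin> {0..1}" for x
    using that by (auto simp: h_def e_def)
  have hpos: "h x > 0" if "0 < x" "x < 1" for x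
    using that by (auto simp: h_def e_def)
  have hnn: "h x \<ge> 0" for x by (auto simp: h_def e_def)
  obtain F where F: "F \<in> smooth" "\<And>x. (F has_real_derivative h x) (at x)" "F 0 = 0"
    using smooth_antiderivE[OF h] by blast
  have F1: "F 1 > 0"
    using DERIV_pos_imp_increasing_open[of 0 1 F] F hpos smooth_continuous_on[OF F(1)] by force
  have left: "F x = 0" if "x \<le> 0" for x
    using constant_outside_support(1)[OF F(2) h0 that] F(3) by metis
  have right: "F x = F 1" if "x \<ge> 1" for x
    using constant_outside_support(2)[OF F(2) h0 that] .
  have mono: "F x \<le> F y" if "x \<le> y" for x y
    by (rule DERIV_nonneg_imp_nondecreasing[OF that]) (use F(2) hnn in blast)
  have bds: "0 \<le> F x" "F x \<le> F 1" for x
    using mono[of 0 x] mono[of x 1] left[of x] right[of x] F1 F(3) by (linarith+)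
  show thesis
  proof (rule that[of "\<lambda>x. inverse (F 1) * F x"])
    show "(\<lambda>x. inverse (F 1) * F x) \<in> smooth"
      by (intro smooth.mult smooth.const F)
    show "inverse (F 1) * F x = 0" if "x \<le> 0" for x
      using left[OF that] by simp
    show "inverse (F 1) * F x = 1" if "x \<ge> 1" for x
      using F1 by (simp add: right[OF that])
    show "0 \<le> inverse (F 1) * F x" "inverse (F 1) * F x \<le> 1" for x
      using bds[of x] F1 by (simp_all add: field_simps)
    show "deriv (\<lambda>x. inverse (F 1) * F x) x = 0" if "x \<notin> {0..1}" for x
      using DERIV_imp_deriv[OF DERIV_cmult[OF F(2)[of x], of "inverse (F 1)"]] h0[OF that] by simp
  qed
qed

subsection \<open>Square integrable and locally integrable functions\<close>

lemma continuous_imp_lebesgue_measurable: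
  fixes f :: "real \<Rightarrow> real"
  shows "continuous_on UNIV f \<Longrightarrow> f \<in> borel_measurable lebesgue"
  by (simp add: borel_measurable_continuous_onI measurable_completion)

lemma compact_support_bounded:
  fixes f :: "real \<Rightarrow> real"
  assumes "continuous_on UNIV f" "\<And>x. x \<notin> {a..b} \<Longrightarrow> f x = 0"
  obtains B where "B \<ge> 0" "\<And>x. \<bar>f x\<bar> \<le> B"
proof -
  have "compact (f ` {a..b})"
    by (intro compact_continuous_image continuous_on_subset[OF assms(1)]) auto
  then have "bounded (f ` {a..b})"
    by (rule compact_imp_bounded)
  then obtain B where "\<forall>y\<in>f ` {a..b}. norm y \<le> B"
    unfolding bounded_iff by blast
  then have B: "\<And>x. x \<in> {a..b} \<Longrightarrow> \<bar>f x\<bar> \<le> B"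
    by simp
  show thesis
    \<comment> \<open>The maximum covers an empty interval, for which \<open>B\<close> could be
      negative.\<close>
    by (rule that[of "max B 0"]) (use B assms(2) in \<open>force simp: le_max_iff_disj\<close>)+
qed

lemma locally_integrable_mult:
  assumes "locally_integrable h" "continuous_on UNIV \<phi>" "\<And>x. x \<notin> {a..b} \<Longrightarrow> \<phi> x = 0"
  shows "integrable lebesgue (\<lambda>x. h x * \<phi> x)"
proof -
  obtain B where B: "B \<ge> 0" "\<And>x. \<bar>\<phi> x\<bar> \<le> B"
    using compact_support_bounded[OF assms(2,3)] by blast
  have i: "integrable lebesgue (\<lambda>x. indicator {a..b} x *\<^sub>R h x)"
    using assms(1) by (simp add: locally_integrable_def set_integrable_def)
  have eq: "h x * \<phi> x = indicator {a..b} x *\<^sub>R h x * \<phi> x" for x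
    using assms(3)[of x] by (auto simp: indicator_def)
  show ?thesis
  proof (rule Bochner_Integration.integrable_bound)
    show "integrable lebesgue (\<lambda>x. B * (indicator {a..b} x *\<^sub>R h x))"
      using i by (rule integrable_mult_right)
    show "(\<lambda>x. h x * \<phi> x) \<in> borel_measurable lebesgue"
      unfolding eq using borel_measurable_integrable[OF i] continuous_imp_lebesgue_measurable[OF assms(2)]
      by (rule borel_measurable_times)
    show "AE x in lebesgue. norm (h x * \<phi> x) \<le> norm (B * (indicator {a..b} x *\<^sub>R h x))"
      by (rule AE_I2, unfold eq) (use B in \<open>simp add: abs_mult mult.commute[of _ "\<bar>\<phi> _\<bar>"] mult_right_mono\<close>)
  qed
qed

section \<open>The pairing and the norm of square integrable functions\<close>

lemma integrable_mult_L2: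
  assumes "f \<in> L2" "g \<in> L2"
  shows "integrable lebesgue (\<lambda>x. f x * g x)"
proof (rule Bochner_Integration.integrable_bound)
  show "integrable lebesgue (\<lambda>x. (f x)\<^sup>2 + (g x)\<^sup>2)"
    using assms by (auto simp: L2_def)
  show "(\<lambda>x. f x * g x) \<in> borel_measurable lebesgue"
    using assms by (auto simp: L2_def intro: borel_measurable_times)
  have "\<bar>x * y\<bar> \<le> x\<^sup>2 + y\<^sup>2" for x y :: real
    using sum_squares_bound[of "\<bar>x\<bar>" "\<bar>y\<bar>"] abs_ge_zero[of "x * y"]
    unfolding abs_mult power2_abs by linarith
  then show "AE x in lebesgue. norm (f x * g x) \<le> norm ((f x)\<^sup>2 + (g x)\<^sup>2)"
    by auto
qed

lemma L2_diff:
  assumes "f \<in> L2" "g \<in> L2"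
  shows "(\<lambda>x. f x - g x) \<in> L2"
proof -
  have eq: "(\<lambda>x. (f x - g x)\<^sup>2) = (\<lambda>x. (f x)\<^sup>2 + (g x)\<^sup>2 - 2 * (f x * g x))"
    by (auto simp: power2_diff)
  have "integrable lebesgue (\<lambda>x. (f x)\<^sup>2 + (g x)\<^sup>2 - 2 * (f x * g x))"
    using assms integrable_mult_L2[OF assms] by (auto simp: L2_def)
  then show ?thesis
    using assms by (auto simp: L2_def eq)
qed

lemma L2_cmult: "f \<in> L2 \<Longrightarrow> (\<lambda>x. f x / c) \<in> L2"
  by (auto simp: L2_def power_divide)

lemma L2_norm_power2: "(L2_norm f)\<^sup>2 = (LINT x|lebesgue. (f x)\<^sup>2)"
  by (simp add: L2_norm_def)

lemma L2_norm_nonneg: "0 \<le> L2_norm f"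
  by (simp add: L2_norm_def)

text \<open>The integral of \<open>(s f - t g)^2\<close> is a nonnegative quadratic form in
  \<open>(s, t)\<close>; its discriminant gives the inequality.\<close>

lemma L2_Cauchy_Schwarz:
  assumes "f \<in> L2" "g \<in> L2"
  shows "\<bar>LINT x|lebesgue. f x * g x\<bar> \<le> L2_norm f * L2_norm g"
proof -
  define A where "A = (LINT x|lebesgue. (f x)\<^sup>2)"
  define B where "B = (LINT x|lebesgue. (g x)\<^sup>2)"
  define D where "D = (LINT x|lebesgue. f x * g x)"
  have i: "integrable lebesgue (\<lambda>x. (f x)\<^sup>2)" "integrable lebesgue (\<lambda>x. (g x)\<^sup>2)"
    "integrable lebesgue (\<lambda>x. f x * g x)"
    using assms integrable_mult_L2[OF assms] by (auto simp: L2_def)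
  have quad: "0 \<le> s\<^sup>2 * A - 2 * s * t * D + t\<^sup>2 * B" for s t
  proof -
    have "0 \<le> (LINT x|lebesgue. (s * f x - t * g x)\<^sup>2)"
      by simp
    also have "\<dots> = (LINT x|lebesgue. s\<^sup>2 * (f x)\<^sup>2 - 2 * s * t * (f x * g x) + t\<^sup>2 * (g x)\<^sup>2)"
      by (simp add: power2_diff power_mult_distrib algebra_simps)
    also have "\<dots> = s\<^sup>2 * A - 2 * s * t * D + t\<^sup>2 * B"
      using i by (simp add: A_def B_def D_def)
    finally show ?thesis .
  qed
  have "D\<^sup>2 \<le> A * B"
  proof (cases "B = 0")
    case True
    have "2 * s * D \<le> A" for s
      using quad[of 1 s] True by simp
    \<comment> \<open>With \<open>B = 0\<close> the form is affine in the remaining parameter; for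
      \<open>D \<noteq> 0\<close> this value would give \<open>A + 1 \<le> A\<close>.\<close>
    from this[of "(A + 1) / (2 * D)"] have "D = 0"
      by (cases "D = 0") auto
    then show ?thesis using True by simp
  next
    case False
    then have "B > 0" by (simp add: B_def less_le)
    \<comment> \<open>The minimising direction \<open>s = B\<close>, \<open>t = D\<close>.\<close>
    moreover have "0 \<le> B * (A * B - D\<^sup>2)"
      using quad[of B D] by (simp add: algebra_simps power2_eq_square)
    ultimately show ?thesis by (simp add: zero_le_mult_iff)
  qed
  then have "sqrt (D\<^sup>2) \<le> sqrt (A * B)" by (rule real_sqrt_le_mono)
  then show ?thesis by (simp add: A_def B_def D_def L2_norm_def real_sqrt_mult)
qed

text \<open>Height times the square root of the length of the support. This balance makes the third
  derivatives of the rescaled cutoffs small, although their supports grow.\<close>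

lemma L2_norm_compact_support:
  assumes "continuous_on UNIV \<phi>" "\<And>x. x \<notin> {a..b} \<Longrightarrow> \<phi> x = 0" "\<And>x. \<bar>\<phi> x\<bar> \<le> B" "a \<le> b"
  shows "\<phi> \<in> L2" "L2_norm \<phi> \<le> B * sqrt (b - a)"
proof -
  have B: "B \<ge> 0" using assms(3)[of 0] by linarith
  have ind: "integrable lebesgue (\<lambda>x. B\<^sup>2 * indicator {a..b} x)"
    by (intro integrable_mult_right integrable_real_indicator) (auto simp: emeasure_lborel_Icc_eq)
  have le: "(\<phi> x)\<^sup>2 \<le> B\<^sup>2 * indicator {a..b} x" for x
    using assms(2)[of x] abs_le_square_iff[of "\<phi> x" B] assms(3)[of x] B
    by (cases "x \<in> {a..b}") auto
  have m: "\<phi> \<in> borel_measurable lebesgue"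
    using continuous_imp_lebesgue_measurable[OF assms(1)] .
  have i: "integrable lebesgue (\<lambda>x. (\<phi> x)\<^sup>2)"
    by (rule Bochner_Integration.integrable_bound[OF ind])
      (use m le in \<open>auto simp: borel_measurable_power\<close>)
  then show "\<phi> \<in> L2" using m by (simp add: L2_def)
  have "(LINT x|lebesgue. (\<phi> x)\<^sup>2) \<le> (LINT x|lebesgue. B\<^sup>2 * indicator {a..b} x)"
    by (rule integral_mono[OF i ind]) (rule le)
  also have "\<dots> = B\<^sup>2 * (b - a)"
    using assms(4) by simp
  finally have "L2_norm \<phi> \<le> sqrt (B\<^sup>2 * (b - a))"
    unfolding L2_norm_def by (rule real_sqrt_le_mono)
  then show "L2_norm \<phi> \<le> B * sqrt (b - a)"
    using B by (simp add: real_sqrt_mult)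
qed

lemma L2_imp_locally_integrable:
  assumes "f \<in> L2"
  shows "locally_integrable f"
  unfolding locally_integrable_def set_integrable_def
proof (intro allI)
  fix a b :: real
  show "integrable lebesgue (\<lambda>x. indicator {a..b} x *\<^sub>R f x)"
  proof (rule Bochner_Integration.integrable_bound)
    show "integrable lebesgue (\<lambda>x. indicator {a..b} x + (f x)\<^sup>2 :: real)"
      using assms by (intro Bochner_Integration.integrable_add integrable_real_indicator)
        (auto simp: L2_def emeasure_lborel_Icc_eq)
    show "(\<lambda>x. indicator {a..b} x *\<^sub>R f x) \<in> borel_measurable lebesgue"
      using assms by (intro borel_measurable_scaleR borel_measurable_indicator) (auto simp: L2_def)
    have "\<bar>y\<bar> \<le> 1 + y\<^sup>2" for y :: real
      using sum_squares_bound[of 1 "\<bar>y\<bar>"] by simp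
    then show "AE x in lebesgue. norm (indicator {a..b} x *\<^sub>R f x) \<le> norm (indicator {a..b} x + (f x)\<^sup>2 :: real)"
      by (auto simp: indicator_def)
  qed
qed

lemma locally_integrable_diff:
  assumes "locally_integrable f" "locally_integrable g"
  shows "locally_integrable (\<lambda>x. f x - g x)"
  using assms unfolding locally_integrable_def by (simp add: set_integral_diff)

text \<open>By Lebesgue differentiation, almost every value of \<open>h\<close> is the limit of its
  means over short intervals starting at the point, so only short intervals have to be
  tested.\<close>

lemma AE_bound_of_interval_bounds:
  assumes "locally_integrable h"
    and bound: "\<And>a b. a < b \<Longrightarrow> b \<le> a + 1 \<Longrightarrow> \<bar>integral {a..b} h\<bar> \<le> M * (b - a)"
  shows "AE x in lebesgue. \<bar>h x\<bar> \<le> M"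
proof -
  have "h integrable_on cbox a b" for a b
    using assms(1) by (simp add: locally_integrable_def set_lebesgue_integral_eq_integral(1))
  then obtain N where N: "negligible N" and lim: "\<And>x e. x \<notin> N \<Longrightarrow> 0 < e \<Longrightarrow>
      \<exists>d>0. \<forall>t. 0 < t \<and> t < d \<longrightarrow>
        norm (integral (cbox x (x + t *\<^sub>R One)) h /\<^sub>R t ^ DIM(real) - h x) < e"
    using integrable_ccontinuous_explicit[of h] by blast
  have "\<bar>h x\<bar> \<le> M" if xN: "x \<notin> N" for x
  proof (rule field_le_epsilon)
    fix e :: real assume "0 < e"
    then obtain d where d: "d > 0" "\<And>t. 0 < t \<Longrightarrow> t < d \<Longrightarrow> \<bar>integral {x..x + t} h / t - h x\<bar> < e"
      using lim[OF xN \<open>0 < e\<close>] by (auto simp: divide_inverse mult.commute)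
    \<comment> \<open>The cap \<open>1\<close> makes \<open>bound\<close> applicable, and
      \<open>d / 2\<close> ensures \<open>t < d\<close>.\<close>
    define t where "t = min 1 (d / 2)"
    have t: "0 < t" "t < d" "t \<le> 1" using d(1) by (auto simp: t_def)
    have "\<bar>integral {x..x + t} h / t\<bar> \<le> M"
      using bound[of x "x + t"] t by (simp add: abs_divide divide_le_eq)
    then show "\<bar>h x\<bar> \<le> M + e" using d(2)[OF t(1,2)] by linarith
  qed
  moreover have "N \<in> null_sets lebesgue" using N by (simp add: negligible_iff_null_sets)
  ultimately show ?thesis by (intro AE_I'[of N]) auto
qed

text \<open>Two steps of slope of order \<open>n\<close>, rising at \<open>a\<close> and falling at
  \<open>b\<close>. The limit indicates the open interval, since the step vanishes at
  \<open>0\<close> and hence both end points get the value \<open>0\<close>.\<close>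

lemma smooth_interval_approximation:
  assumes "a < b"
  obtains \<rho> where "\<And>n. \<rho> n \<in> smooth" "\<And>n x. 0 \<le> \<rho> n x" "\<And>n x. \<rho> n x \<le> 1"
    "\<And>n x. x \<notin> {a..b} \<Longrightarrow> \<rho> n x = 0" "\<And>x. (\<lambda>n. \<rho> n x) \<longlonglongrightarrow> indicator {a<..<b} x"
proof -
  obtain \<theta> where \<theta>: "\<theta> \<in> smooth" "\<And>x. x \<le> 0 \<Longrightarrow> \<theta> x = 0" "\<And>x. x \<ge> 1 \<Longrightarrow> \<theta> x = 1"
    "\<And>x. 0 \<le> \<theta> x" "\<And>x. \<theta> x \<le> 1"
    by (rule smooth_stepE) blast
  have lim: "(\<lambda>n. \<theta> (real n * y)) \<longlonglongrightarrow> (if y > 0 then 1 else 0)" for y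
  proof (cases "y > 0")
    case True
    have "\<forall>\<^sub>F n in sequentially. real n \<ge> 1 / y"
      using eventually_ge_at_top[of "nat \<lceil>1 / y\<rceil>"] by eventually_elim linarith
    then have "\<forall>\<^sub>F n in sequentially. \<theta> (real n * y) = 1"
      by eventually_elim (use True \<theta>(3) in \<open>simp add: divide_le_eq\<close>)
    then show ?thesis using True tendsto_eventually by auto
  next
    case False
    then have "\<theta> (real n * y) = 0" for n
      by (intro \<theta>(2)) (simp add: mult_nonneg_nonpos)
    then show ?thesis using False by simp
  qed
  show thesis
  \<comment> \<open>The arguments \<open>n (x - a)\<close> and \<open>n (b - x)\<close> are expanded
    into the shape that \<open>smooth.affine\<close> expects.\<close>
  proof (rule that[of "\<lambda>n x. \<theta> (real n * x + - real n * a) * \<theta> (- real n * x + real n * b)"])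
    fix n x
    show "(\<lambda>x. \<theta> (real n * x + - real n * a) * \<theta> (- real n * x + real n * b)) \<in> smooth"
      by (intro smooth.mult smooth.affine \<theta>)
    show "0 \<le> \<theta> (real n * x + - real n * a) * \<theta> (- real n * x + real n * b)"
      "\<theta> (real n * x + - real n * a) * \<theta> (- real n * x + real n * b) \<le> 1"
      using \<theta>(4,5) by (auto intro: mult_le_one)
    show "\<theta> (real n * x + - real n * a) * \<theta> (- real n * x + real n * b) = 0" if "x \<notin> {a..b}"
      using that \<theta>(2)[of "real n * x + - real n * a"] \<theta>(2)[of "- real n * x + real n * b"]
      by (cases "x < a") (auto simp: mult_left_mono)
    have "(\<lambda>n. \<theta> (real n * (x - a)) * \<theta> (real n * (b - x)))
        \<longlonglongrightarrow> (if x - a > 0 then 1 else 0) * (if b - x > 0 then 1 else 0)"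
      by (intro tendsto_mult lim)
    then show "(\<lambda>n. \<theta> (real n * x + - real n * a) * \<theta> (- real n * x + real n * b))
        \<longlonglongrightarrow> indicator {a<..<b} x"
      by (simp add: algebra_simps indicator_def split: if_splits)
  qed
qed

text \<open>Smooth approximations of an indicator replace the indicator by dominated convergence.
  This permits a pointwise bound to be derived by duality, from weak identities tested with smooth
  functions.\<close>

lemma AE_bound_of_smooth_bounds:
  assumes h: "locally_integrable h"
    and bound: "\<And>a b \<rho>. \<lbrakk>a < b; b \<le> a + 1; \<rho> \<in> smooth; \<And>x. 0 \<le> \<rho> x; \<And>x. \<rho> x \<le> 1;
      \<And>x. x \<notin> {a..b} \<Longrightarrow> \<rho> x = 0\<rbrakk> \<Longrightarrow> \<bar>LINT x|lebesgue. h x * \<rho> x\<bar> \<le> M * (b - a)"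
  shows "AE x in lebesgue. \<bar>h x\<bar> \<le> M"
proof (rule AE_bound_of_interval_bounds[OF h])
  fix a b :: real assume ab: "a < b" "b \<le> a + 1"
  obtain \<rho> where \<rho>: "\<And>n. \<rho> n \<in> smooth" "\<And>n x. 0 \<le> \<rho> n x" "\<And>n x. \<rho> n x \<le> 1"
    "\<And>n x. x \<notin> {a..b} \<Longrightarrow> \<rho> n x = 0" "\<And>x. (\<lambda>n. \<rho> n x) \<longlonglongrightarrow> indicator {a<..<b} x"
    using smooth_interval_approximation[OF ab(1)] by blast
  have i: "set_integrable lebesgue {a..b} h"
    using h by (simp add: locally_integrable_def)
  have io: "set_integrable lebesgue {a<..<b} h"
    by (rule set_integrable_subset[OF i]) auto
  have "(\<lambda>n. LINT x|lebesgue. h x * \<rho> n x) \<longlonglongrightarrow> (LINT x|lebesgue. indicator {a<..<b} x *\<^sub>R h x)"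
  proof (rule integral_dominated_convergence)
    show "(\<lambda>x. indicator {a<..<b} x *\<^sub>R h x) \<in> borel_measurable lebesgue"
      using io by (auto simp: set_integrable_def)
    show "(\<lambda>x. h x * \<rho> n x) \<in> borel_measurable lebesgue" for n
      by (intro borel_measurable_integrable locally_integrable_mult[OF h smooth_continuous_on])
        (use \<rho>(1,4) in auto)
    show "integrable lebesgue (\<lambda>x. \<bar>indicator {a..b} x *\<^sub>R h x\<bar>)"
      using i by (auto simp: set_integrable_def)
    show "AE x in lebesgue. (\<lambda>n. h x * \<rho> n x) \<longlonglongrightarrow> indicator {a<..<b} x *\<^sub>R h x"
      using tendsto_mult[OF tendsto_const \<rho>(5)] by (simp add: mult.commute)
    show "AE x in lebesgue. norm (h x * \<rho> n x) \<le> \<bar>indicator {a..b} x *\<^sub>R h x\<bar>" for n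
      using \<rho>(2,3)[of n] \<rho>(4)[of _ n]
      by (intro AE_I2) (auto simp: indicator_def abs_mult intro!: mult_left_le)
  qed
  then have "(\<lambda>n. \<bar>LINT x|lebesgue. h x * \<rho> n x\<bar>) \<longlonglongrightarrow> \<bar>LINT x:{a<..<b}|lebesgue. h x\<bar>"
    unfolding set_lebesgue_integral_def by (rule tendsto_rabs)
  then have "\<bar>LINT x:{a<..<b}|lebesgue. h x\<bar> \<le> M * (b - a)"
    by (rule LIMSEQ_le_const2) (use bound[OF ab \<rho>(1-4)] in blast)
  then show "\<bar>integral {a..b} h\<bar> \<le> M * (b - a)"
    by (simp add: set_lebesgue_integral_eq_integral(2)[OF io] integral_open_interval_real)
qed

text \<open>The fundamental lemma of the calculus of variations, as the case \<open>M = 0\<close> of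
  the preceding bound.\<close>

lemma AE_zero_of_smooth_integrals:
  assumes "locally_integrable h"
    and "\<And>\<rho> a b. \<rho> \<in> smooth \<Longrightarrow> (\<And>x. x \<notin> {a..b} \<Longrightarrow> \<rho> x = 0) \<Longrightarrow> (LINT x|lebesgue. h x * \<rho> x) = 0"
  shows "AE x in lebesgue. h x = 0"
proof -
  have "AE x in lebesgue. \<bar>h x\<bar> \<le> 0"
  proof (rule AE_bound_of_smooth_bounds[OF assms(1)])
    fix a b :: real and \<rho> :: "real \<Rightarrow> real"
    assume "\<rho> \<in> smooth" "\<And>x. x \<notin> {a..b} \<Longrightarrow> \<rho> x = 0"
    from assms(2)[OF this] show "\<bar>LINT x|lebesgue. h x * \<rho> x\<bar> \<le> 0 * (b - a)"
      by simp
  qed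
  then show ?thesis by simp
qed

subsection \<open>Weak derivatives and Sobolev embedding\<close>

lemma integrable_mult_smooth_derivs:
  assumes "\<rho> \<in> smooth" "\<And>x. x \<notin> {a..b} \<Longrightarrow> \<rho> x = 0" "locally_integrable h"
  shows "integrable lebesgue (\<lambda>x. h x * (deriv ^^ n) \<rho> x)"
  using assms derivs_zero_outside[of a b \<rho>]
  by (intro locally_integrable_mult smooth_continuous_on smooth_derivs) auto

lemma has_weak_deriv_smooth:
  assumes "has_weak_deriv j f g" "\<rho> \<in> smooth" "\<And>x. x \<notin> {a..b} \<Longrightarrow> \<rho> x = 0"
  shows "(LINT x|lebesgue. f x * (deriv ^^ j) \<rho> x) = (-1) ^ j * (LINT x|lebesgue. g x * \<rho> x)"
  using assms(1) smooth_test_function[OF assms(2,3)] by (simp add: has_weak_deriv_def)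

text \<open>Since \<open>weak_deriv\<close> is a choice by \<open>SOME\<close>, facts about a known
  weak derivative reach the chosen one only through this uniqueness.\<close>

lemma has_weak_deriv_unique:
  assumes "has_weak_deriv j f g" "has_weak_deriv j f g'"
  shows "AE x in lebesgue. g x = g' x"
proof -
  have li: "locally_integrable g" "locally_integrable g'"
    using assms by (auto simp: has_weak_deriv_def)
  have "AE x in lebesgue. g x - g' x = 0"
  proof (rule AE_zero_of_smooth_integrals[OF locally_integrable_diff[OF li]])
    fix \<rho> :: "real \<Rightarrow> real" and a b :: real
    assume \<rho>: "\<rho> \<in> smooth" "\<And>x. x \<notin> {a..b} \<Longrightarrow> \<rho> x = 0"
    have "(LINT x|lebesgue. g x * \<rho> x) = (LINT x|lebesgue. g' x * \<rho> x)"
      using has_weak_deriv_smooth[OF assms(1) \<rho>] has_weak_deriv_smooth[OF assms(2) \<rho>] by simp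
    moreover have "integrable lebesgue (\<lambda>x. g x * \<rho> x)" "integrable lebesgue (\<lambda>x. g' x * \<rho> x)"
      using integrable_mult_smooth_derivs[OF \<rho>, where n = 0] li by auto
    ultimately show "(LINT x|lebesgue. (g x - g' x) * \<rho> x) = 0"
      by (simp add: left_diff_distrib)
  qed
  then show ?thesis by simp
qed

lemma has_weak_deriv_0: "locally_integrable f \<Longrightarrow> has_weak_deriv 0 f f"
  by (simp add: has_weak_deriv_def)

text \<open>Local integrability yields measurability on each bounded interval; \<open>h\<close> is
  the pointwise limit of its truncations.\<close>

lemma locally_integrable_measurable:
  assumes "locally_integrable h"
  shows "h \<in> borel_measurable lebesgue"
proof (rule borel_measurable_LIMSEQ_real)
  show "(\<lambda>n. indicator {- real n..real n} x * h x) \<longlonglongrightarrow> h x" for x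
  proof (rule tendsto_eventually)
    show "\<forall>\<^sub>F n in sequentially. indicator {- real n..real n} x * h x = h x"
      using eventually_ge_at_top[of "nat \<lceil>\<bar>x\<bar>\<rceil>"]
      by eventually_elim (auto simp: indicator_def)
  qed
  show "(\<lambda>x. indicator {- real n..real n} x * h x) \<in> borel_measurable lebesgue" for n
    using assms borel_measurable_integrable[of lebesgue "\<lambda>x. indicator {- real n..real n} x *\<^sub>R h x"]
    by (simp add: locally_integrable_def set_integrable_def)
qed

lemma L2_cong_AE:
  assumes "f \<in> L2" "g \<in> borel_measurable lebesgue" "AE x in lebesgue. f x = g x"
  shows "g \<in> L2" "L2_norm g = L2_norm f"
proof -
  have f: "f \<in> borel_measurable lebesgue" "integrable lebesgue (\<lambda>x. (f x)\<^sup>2)"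
    using assms(1) by (auto simp: L2_def)
  have m: "(\<lambda>x. (f x)\<^sup>2) \<in> borel_measurable lebesgue" "(\<lambda>x. (g x)\<^sup>2) \<in> borel_measurable lebesgue"
    using f(1) assms(2) by (auto intro: borel_measurable_power)
  have ae: "AE x in lebesgue. (f x)\<^sup>2 = (g x)\<^sup>2"
    using assms(3) by eventually_elim simp
  show "g \<in> L2"
    using assms(2) f(2) integrable_cong_AE[OF m ae] by (simp add: L2_def)
  show "L2_norm g = L2_norm f"
    using integral_cong_AE[OF m ae] by (simp add: L2_norm_def)
qed

text \<open>The function chosen by \<open>SOME\<close> may differ from the square integrable one in
  the definition of \<open>sobolev\<close>, but only on a null set.\<close>

lemma weak_deriv_sobolev:
  assumes "f \<in> sobolev s" "j \<le> s"
  shows "has_weak_deriv j f (weak_deriv j f)" "weak_deriv j f \<in> L2"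
proof -
  obtain g where g: "g \<in> L2" "has_weak_deriv j f g"
    using assms by (auto simp: sobolev_def)
  show w: "has_weak_deriv j f (weak_deriv j f)"
    unfolding weak_deriv_def by (rule someI[of _ g]) (rule g(2))
  then have "weak_deriv j f \<in> borel_measurable lebesgue"
    by (simp add: has_weak_deriv_def locally_integrable_measurable)
  then show "weak_deriv j f \<in> L2"
    using L2_cong_AE(1)[OF g(1)] has_weak_deriv_unique[OF g(2) w] by blast
qed

lemma L2_norm_weak_deriv_le:
  assumes "j \<le> s"
  shows "L2_norm (weak_deriv j f) \<le> sobolev_norm s f"
  unfolding sobolev_norm_def
proof (rule real_le_rsqrt)
  show "(L2_norm (weak_deriv j f))\<^sup>2 \<le> (\<Sum>j\<le>s. (L2_norm (weak_deriv j f))\<^sup>2)"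
    using assms by (intro member_le_sum) auto
qed

text \<open>The term \<open>j = 0\<close> of the Sobolev norm involves
  \<open>weak_deriv 0 f\<close>, which agrees with \<open>f\<close> almost everywhere.\<close>

lemma L2_norm_le_sobolev_norm:
  assumes "f \<in> sobolev s"
  shows "L2_norm f \<le> sobolev_norm s f"
proof -
  have f: "f \<in> L2" using assms by (simp add: sobolev_def)
  have w: "has_weak_deriv 0 f (weak_deriv 0 f)" "weak_deriv 0 f \<in> L2"
    using weak_deriv_sobolev[OF assms, of 0] by auto
  have "L2_norm (weak_deriv 0 f) = L2_norm f"
    using L2_cong_AE(2)[OF f] w(2)
      has_weak_deriv_unique[OF has_weak_deriv_0[OF L2_imp_locally_integrable[OF f]] w(1)]
    by (auto simp: L2_def)
  then show ?thesis
    using L2_norm_weak_deriv_le[of 0 s f] by simp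
qed

text \<open>To estimate the mean of \<open>f\<close> over a short interval, the weak derivative is tested against a
  function that climbs from \<open>0\<close> to the mass of \<open>\<rho>\<close> across the interval and descends to the right of
  it at a fixed slope.\<close>

lemma weak_deriv_sup_bound:
  obtains C where "C > 0" "\<And>f g. f \<in> L2 \<Longrightarrow> g \<in> L2 \<Longrightarrow> has_weak_deriv 1 f g \<Longrightarrow>
    AE x in lebesgue. \<bar>f x\<bar> \<le> C * (L2_norm f + L2_norm g)"
proof -
  obtain \<theta> where \<theta>: "\<theta> \<in> smooth" "\<And>x. x \<le> 0 \<Longrightarrow> \<theta> x = 0" "\<And>x. x \<ge> 1 \<Longrightarrow> \<theta> x = 1"
    "\<And>x. 0 \<le> \<theta> x" "\<And>x. \<theta> x \<le> 1" "\<And>x. x \<notin> {0..1} \<Longrightarrow> deriv \<theta> x = 0"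
    using smooth_stepE by blast
  obtain K where K: "K \<ge> 0" "\<And>x. \<bar>deriv \<theta> x\<bar> \<le> K"
    using compact_support_bounded[OF smooth_continuous_on[OF smooth_deriv[OF \<theta>(1)]] \<theta>(6)] by blast
  have "AE x in lebesgue. \<bar>f x\<bar> \<le> (K + 2) * (L2_norm f + L2_norm g)"
    if f: "f \<in> L2" and g: "g \<in> L2" and fg: "has_weak_deriv 1 f g" for f g
  proof (rule AE_bound_of_smooth_bounds[OF L2_imp_locally_integrable[OF f]])
    fix a b :: real and \<rho> :: "real \<Rightarrow> real"
    assume ab: "a < b" "b \<le> a + 1" and \<rho>: "\<rho> \<in> smooth" "\<And>x. 0 \<le> \<rho> x" "\<And>x. \<rho> x \<le> 1"
      "\<And>x. x \<notin> {a..b} \<Longrightarrow> \<rho> x = 0"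
    obtain \<Theta> where \<Theta>: "\<Theta> \<in> smooth" "\<And>x. (\<Theta> has_real_derivative \<rho> x) (at x)" "\<Theta> a = 0"
      using smooth_antiderivE[OF \<rho>(1)] by blast
    have left: "\<Theta> x = 0" if "x \<le> a" for x
      using constant_outside_support(1)[OF \<Theta>(2) \<rho>(4) that] \<Theta>(3) by simp
    have right: "\<Theta> x = \<Theta> b" if "x \<ge> b" for x
      using constant_outside_support(2)[OF \<Theta>(2) \<rho>(4) that] .
    have mono: "\<Theta> x \<le> \<Theta> y" if "x \<le> y" for x y
      by (rule DERIV_nonneg_imp_nondecreasing[OF that]) (use \<Theta>(2) \<rho>(2) in blast)
    \<comment> \<open>Because \<open>\<rho> \<le> 1\<close>, the climb of \<open>\<Theta>\<close> is
      at most the length of the interval. All later estimates inherit the factor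
      \<open>b - a\<close> from this.\<close>
    have "a - \<Theta> a \<le> b - \<Theta> b"
    proof (rule DERIV_nonneg_imp_nondecreasing[of a b "\<lambda>x. x - \<Theta> x"])
      show "\<exists>y. ((\<lambda>x. x - \<Theta> x) has_real_derivative y) (at x) \<and> 0 \<le> y" for x
        by (rule exI[of _ "1 - \<rho> x"]) (auto intro!: derivative_eq_intros \<Theta>(2) simp: \<rho>(3))
    qed (use ab in simp)
    then have \<Theta>b: "0 \<le> \<Theta> b" "\<Theta> b \<le> b - a"
      using mono[of a b] ab \<Theta>(3) by auto
    have \<Theta>bd: "\<bar>\<Theta> x\<bar> \<le> b - a" for x
      using mono[of x b] mono[of a x] left[of x] right[of x] \<Theta>(3) \<Theta>b by linarith
    \<comment> \<open>\<open>\<kappa>\<close> is \<open>1\<close> to the left of \<open>b\<close>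
      and \<open>0\<close> to the right of \<open>b + 1\<close>; its descent \<open>\<eta>\<close>
      lives on the unit interval between them.\<close>
    define \<kappa> where "\<kappa> x = \<theta> (- 1 * x + (b + 1))" for x
    define \<eta> where "\<eta> x = deriv \<theta> (- 1 * x + (b + 1))" for x
    have \<kappa>: "\<kappa> \<in> smooth" and \<eta>: "\<eta> \<in> smooth"
      unfolding \<kappa>_def[abs_def] \<eta>_def[abs_def]
      by (rule smooth.affine[OF \<theta>(1)], rule smooth.affine[OF smooth_deriv[OF \<theta>(1)]])
    have \<kappa>': "(\<kappa> has_real_derivative - \<eta> x) (at x)" for x
    proof -
      have "((\<lambda>x. - 1 * x + (b + 1)) has_real_derivative - 1) (at x)"
        by (auto intro!: derivative_eq_intros)
      from DERIV_chain2[OF smooth_has_deriv[OF \<theta>(1)] this] show ?thesis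
        unfolding \<kappa>_def[abs_def] \<eta>_def by simp
    qed
    have \<eta>0: "\<eta> x = 0" if "x \<notin> {b..b + 1}" for x
      unfolding \<eta>_def by (rule \<theta>(6)) (use that in auto)
    have \<eta>L2: "\<eta> \<in> L2" "L2_norm \<eta> \<le> K"
      using L2_norm_compact_support[where a = b and b = "b + 1" and B = K, OF smooth_continuous_on[OF \<eta>] \<eta>0]
        K(2) by (simp_all add: \<eta>_def[abs_def])
    define \<phi> where "\<phi> x = \<Theta> x * \<kappa> x" for x
    have \<phi>: "\<phi> \<in> smooth"
      unfolding \<phi>_def[abs_def] by (intro smooth.mult \<Theta> \<kappa>)
    have \<phi>0: "\<phi> x = 0" if "x \<notin> {a..b + 1}" for x
      using that left[of x] \<theta>(2)[of "- 1 * x + (b + 1)"] by (auto simp: \<phi>_def \<kappa>_def)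
    have \<phi>bd: "\<bar>\<phi> x\<bar> \<le> b - a" for x
      using mult_mono[OF \<Theta>bd[of x], of "\<bar>\<kappa> x\<bar>" 1] \<theta>(4,5) ab by (auto simp: \<phi>_def \<kappa>_def abs_mult)
    have \<phi>L2: "\<phi> \<in> L2" "L2_norm \<phi> \<le> (b - a) * sqrt (b + 1 - a)"
      using L2_norm_compact_support[OF smooth_continuous_on[OF \<phi>] \<phi>0 \<phi>bd] ab by auto
    \<comment> \<open>Here \<open>b \<le> a + 1\<close> enters: the support of \<open>\<phi>\<close>
      has length at most \<open>2\<close>, whatever the short interval.\<close>
    have "sqrt (b + 1 - a) \<le> 2"
      using ab by (intro real_le_lsqrt) auto
    then have \<phi>2: "L2_norm \<phi> \<le> (b - a) * 2"
      using \<phi>L2(2) ab mult_left_mono[of "sqrt (b + 1 - a)" 2 "b - a"] by simp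
    \<comment> \<open>The product rule simplifies because \<open>\<kappa> = 1\<close> on the support
      of \<open>\<rho>\<close> and \<open>\<Theta> = \<Theta> b\<close> on the support of
      \<open>\<eta>\<close>.\<close>
    have \<phi>': "deriv \<phi> x = \<rho> x - \<Theta> b * \<eta> x" for x
    proof -
      have "(\<phi> has_real_derivative \<rho> x * \<kappa> x + - \<eta> x * \<Theta> x) (at x)"
        unfolding \<phi>_def[abs_def] by (rule DERIV_mult[OF \<Theta>(2) \<kappa>'])
      then have "deriv \<phi> x = \<rho> x * \<kappa> x - \<eta> x * \<Theta> x"
        using DERIV_imp_deriv by fastforce
      also have "\<rho> x * \<kappa> x = \<rho> x"
        using \<rho>(4)[of x] \<theta>(3)[of "- 1 * x + (b + 1)"] by (cases "x \<le> b") (auto simp: \<kappa>_def)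
      also have "\<eta> x * \<Theta> x = \<Theta> b * \<eta> x"
        using \<eta>0[of x] right[of x] by (cases "x < b") auto
      finally show ?thesis .
    qed
    have "(LINT x|lebesgue. f x * (\<rho> x - \<Theta> b * \<eta> x)) = - (LINT x|lebesgue. g x * \<phi> x)"
      using has_weak_deriv_smooth[OF fg \<phi> \<phi>0] \<phi>' by simp
    moreover have "(LINT x|lebesgue. f x * (\<rho> x - \<Theta> b * \<eta> x)) =
        (LINT x|lebesgue. f x * \<rho> x - \<Theta> b * (f x * \<eta> x))"
      by (simp add: algebra_simps)
    moreover have "\<dots> = (LINT x|lebesgue. f x * \<rho> x) - \<Theta> b * (LINT x|lebesgue. f x * \<eta> x)"
      using locally_integrable_mult[OF L2_imp_locally_integrable[OF f] smooth_continuous_on[OF \<rho>(1)] \<rho>(4)]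
        integrable_mult_L2[OF f \<eta>L2(1)] by simp
    ultimately have "\<bar>LINT x|lebesgue. f x * \<rho> x\<bar> \<le>
        \<bar>\<Theta> b * (LINT x|lebesgue. f x * \<eta> x)\<bar> + \<bar>LINT x|lebesgue. g x * \<phi> x\<bar>"
      by linarith
    also have "\<bar>\<Theta> b * (LINT x|lebesgue. f x * \<eta> x)\<bar> \<le> (b - a) * (L2_norm f * K)"
      unfolding abs_mult
      using \<Theta>b L2_Cauchy_Schwarz[OF f \<eta>L2(1)] mult_left_mono[OF \<eta>L2(2) L2_norm_nonneg[of f]]
      by (intro mult_mono) auto
    also have "\<bar>LINT x|lebesgue. g x * \<phi> x\<bar> \<le> L2_norm g * ((b - a) * 2)"
      using L2_Cauchy_Schwarz[OF g \<phi>L2(1)] mult_left_mono[OF \<phi>2 L2_norm_nonneg[of g]] by linarith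
    also have "(b - a) * (L2_norm f * K) + L2_norm g * ((b - a) * 2) =
        (K * L2_norm f + 2 * L2_norm g) * (b - a)"
      by (simp add: algebra_simps)
    also have "\<dots> \<le> (K + 2) * (L2_norm f + L2_norm g) * (b - a)"
    proof (rule mult_right_mono)
      have "0 \<le> 2 * L2_norm f + K * L2_norm g"
        using K(1) L2_norm_nonneg[of f] L2_norm_nonneg[of g] by simp
      then show "K * L2_norm f + 2 * L2_norm g \<le> (K + 2) * (L2_norm f + L2_norm g)"
        by (simp add: algebra_simps)
    qed (use ab in simp)
    finally show "\<bar>LINT x|lebesgue. f x * \<rho> x\<bar> \<le> (K + 2) * (L2_norm f + L2_norm g) * (b - a)"
      by simp
  qed
  then show thesis
    using that[of "K + 2"] K(1) by auto
qed

lemma sobolev_1_sup_bound: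
  obtains C where "C > 0" "\<And>f. f \<in> sobolev 1 \<Longrightarrow> AE x in lebesgue. \<bar>f x\<bar> \<le> C * sobolev_norm 1 f"
proof -
  obtain C where C: "C > 0" "\<And>f g. f \<in> L2 \<Longrightarrow> g \<in> L2 \<Longrightarrow> has_weak_deriv 1 f g \<Longrightarrow>
      AE x in lebesgue. \<bar>f x\<bar> \<le> C * (L2_norm f + L2_norm g)"
    using weak_deriv_sup_bound by blast
  have "AE x in lebesgue. \<bar>f x\<bar> \<le> 2 * C * sobolev_norm 1 f" if f: "f \<in> sobolev 1" for f
  proof -
    have "f \<in> L2" using f by (simp add: sobolev_def)
    then have "AE x in lebesgue. \<bar>f x\<bar> \<le> C * (L2_norm f + L2_norm (weak_deriv 1 f))"
      using C(2) weak_deriv_sobolev[OF f, of 1] by simp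
    moreover have "C * (L2_norm f + L2_norm (weak_deriv 1 f)) \<le> C * (2 * sobolev_norm 1 f)"
      using C(1) L2_norm_le_sobolev_norm[OF f] L2_norm_weak_deriv_le[of 1 1 f]
      by (intro mult_left_mono) auto
    ultimately show ?thesis by (auto elim!: eventually_mono)
  qed
  then show thesis using that[of "2 * C"] C(1) by auto
qed

subsection \<open>Moments of a strong solution\<close>

text \<open>Pairing with \<open>\<phi>\<close> is a bounded functional by Cauchy-Schwarz, so it
  passes through the limit of the difference quotients.\<close>

lemma has_L2_time_deriv_pairing:
  assumes u: "has_L2_time_deriv u w t" and \<phi>: "\<phi> \<in> L2"
  shows "((\<lambda>s. LINT x|lebesgue. u s x * \<phi> x) has_real_derivative (LINT x|lebesgue. w x * \<phi> x)) (at t)"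
proof -
  have wL: "w \<in> L2" and uL: "u s \<in> L2" for s
    using u by (auto simp: has_L2_time_deriv_def)
  let ?q = "\<lambda>h x. (u (t + h) x - u t x) / h - w x"
  have qL: "?q h \<in> L2" for h
    by (intro L2_diff L2_cmult uL wL)
  \<comment> \<open>No case distinction at \<open>h = 0\<close> arises: division by zero gives
    \<open>0\<close> on both sides.\<close>
  have eq: "((LINT x|lebesgue. u (t + h) x * \<phi> x) - (LINT x|lebesgue. u t x * \<phi> x)) / h
      - (LINT x|lebesgue. w x * \<phi> x) = (LINT x|lebesgue. ?q h x * \<phi> x)" for h
  proof -
    have "(LINT x|lebesgue. ?q h x * \<phi> x) =
        (LINT x|lebesgue. (u (t + h) x * \<phi> x - u t x * \<phi> x) / h - w x * \<phi> x)"
      by (simp add: left_diff_distrib)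
    then show ?thesis
      using integrable_mult_L2[OF uL \<phi>] integrable_mult_L2[OF wL \<phi>] by simp
  qed
  have "((\<lambda>h. L2_norm (?q h)) \<longlongrightarrow> 0) (at 0)"
    using u by (simp add: has_L2_time_deriv_def)
  then have "((\<lambda>h. L2_norm (?q h) * L2_norm \<phi>) \<longlongrightarrow> 0) (at 0)"
    by (rule tendsto_mult_left_zero)
  then have "((\<lambda>h. LINT x|lebesgue. ?q h x * \<phi> x) \<longlongrightarrow> 0) (at 0)"
    by (rule Lim_null_comparison[rotated])
      (use L2_Cauchy_Schwarz[OF qL \<phi>] in \<open>simp add: always_eventually\<close>)
  then show ?thesis
    unfolding DERIV_def eq[symmetric] by (simp add: LIM_zero_iff)
qed

text \<open>The outer space derivative moves to \<open>\<phi>\<close>, its sign cancelling the one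
  in the equation; then the two derivatives on \<open>u\<close> move to \<open>\<phi>'\<close>,
  which yields the third derivative.\<close>

lemma strong_solution_pairing:
  assumes "strong_solution s r f u" "\<phi> \<in> smooth" "\<And>x. x \<notin> {a..b} \<Longrightarrow> \<phi> x = 0"
  shows "((\<lambda>t. LINT x|lebesgue. u t x * \<phi> x) has_real_derivative
    (LINT x|lebesgue. u t x * (deriv ^^ 3) \<phi> x) + (LINT x|lebesgue. f (u t x) * deriv \<phi> x)) (at t)"
proof -
  obtain ut uxx Fx where ut: "has_L2_time_deriv u ut t" and uxx: "has_weak_deriv 2 (u t) uxx"
    and Fx: "has_weak_deriv 1 (\<lambda>x. uxx x + f (u t x)) Fx" and eq: "AE x in lebesgue. ut x + Fx x = 0"
    using assms(1) unfolding strong_solution_def by meson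
  have \<phi>': "deriv \<phi> \<in> smooth" "\<And>x. x \<notin> {a..b} \<Longrightarrow> deriv \<phi> x = 0"
    using smooth_deriv[OF assms(2)] deriv_zero_outside[of a b \<phi>] assms(3) by blast+
  obtain B where "\<And>x. \<bar>\<phi> x\<bar> \<le> B"
    using compact_support_bounded[OF smooth_continuous_on[OF assms(2)] assms(3)] by blast
  \<comment> \<open>The interval may be empty, while \<open>L2_norm_compact_support\<close> asks for
    ordered end points.\<close>
  moreover have "\<phi> x = 0" if "x \<notin> {a..max a b}" for x
    using that assms(3)[of x] by (auto simp: max_def split: if_splits)
  ultimately have \<phi>L: "\<phi> \<in> L2"
    by (intro L2_norm_compact_support(1)[OF smooth_continuous_on[OF assms(2)], of a "max a b"]) auto
  have li: "locally_integrable uxx" "locally_integrable (\<lambda>x. uxx x + f (u t x))" "locally_integrable Fx"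
    using uxx Fx by (auto simp: has_weak_deriv_def)
  \<comment> \<open>A strong solution controls \<open>u_xx\<close> and the sum
    \<open>u_xx + f(u)\<close>; the nonlinear term is their difference.\<close>
  have lf: "locally_integrable (\<lambda>x. f (u t x))"
    using locally_integrable_diff[OF li(2,1)] by simp
  have "(LINT x|lebesgue. ut x * \<phi> x) = (LINT x|lebesgue. - (Fx x * \<phi> x))"
  proof (rule integral_cong_AE)
    show "(\<lambda>x. ut x * \<phi> x) \<in> borel_measurable lebesgue"
      using ut integrable_mult_L2[OF _ \<phi>L] by (auto simp: has_L2_time_deriv_def)
    show "(\<lambda>x. - (Fx x * \<phi> x)) \<in> borel_measurable lebesgue"
      using locally_integrable_mult[OF li(3) smooth_continuous_on[OF assms(2)] assms(3)] by auto
    show "AE x in lebesgue. ut x * \<phi> x = - (Fx x * \<phi> x)"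
      using eq
    proof eventually_elim
      case (elim x)
      then have "ut x = - Fx x" by linarith
      then show ?case by simp
    qed
  qed
  also have "\<dots> = (LINT x|lebesgue. (uxx x + f (u t x)) * deriv \<phi> x)"
    using has_weak_deriv_smooth[OF Fx assms(2,3)] by simp
  also have "\<dots> = (LINT x|lebesgue. uxx x * deriv \<phi> x) + (LINT x|lebesgue. f (u t x) * deriv \<phi> x)"
    using locally_integrable_mult[OF li(1) smooth_continuous_on[OF \<phi>'(1)] \<phi>'(2)]
      locally_integrable_mult[OF lf smooth_continuous_on[OF \<phi>'(1)] \<phi>'(2)]
    by (simp add: distrib_right)
  also have "(LINT x|lebesgue. uxx x * deriv \<phi> x) = (LINT x|lebesgue. u t x * (deriv ^^ 3) \<phi> x)"
    using has_weak_deriv_smooth[OF uxx \<phi>'] by (simp add: eval_nat_numeral)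
  finally show ?thesis
    using has_L2_time_deriv_pairing[OF ut \<phi>L] by simp
qed

section \<open>Ingredients of the periodicity argument\<close>

lemma derivs_scaled:
  assumes "\<psi> \<in> smooth"
  shows "(deriv ^^ j) (\<lambda>x. d * \<psi> (c * x)) = (\<lambda>x. d * c ^ j * (deriv ^^ j) \<psi> (c * x))"
proof (induction j)
  case (Suc j)
  have step: "deriv (\<lambda>x. d * c ^ j * (deriv ^^ j) \<psi> (c * x)) x =
      d * c ^ j * (deriv ((deriv ^^ j) \<psi>) (c * x) * c)" for x
    by (intro DERIV_imp_deriv DERIV_cmult DERIV_chain2[OF smooth_has_deriv[OF smooth_derivs[OF assms]]])
      (auto intro!: derivative_eq_intros)
  show ?case
    unfolding funpow.simps o_apply Suc fun_eq_iff by (intro allI, subst step) (simp add: mult_ac)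
qed simp

text \<open>Near \<open>0\<close> the remainder is at most half of \<open>s^(2k)\<close>, so
  \<open>f\<close> lies between one half and three halves of that power; for
  \<open>\<bar>s\<bar> \<le> 1\<close> and \<open>k \<ge> 1\<close> the power is at most
  \<open>s^2\<close>.\<close>

lemma nonlinearity_bounds:
  fixes f f2k :: "real \<Rightarrow> real"
  assumes "k \<ge> 1" "\<And>s. f s = s ^ (2 * k) + f2k s" "C_times (2 * k) f2k"
    and "((\<lambda>s. f2k s / \<bar>s\<bar> ^ (2 * k)) \<longlongrightarrow> 0) (at 0)"
  obtains \<delta> where "\<delta> > 0" "\<And>s. \<bar>s\<bar> \<le> \<delta> \<Longrightarrow> s ^ (2 * k) / 2 \<le> f s" "\<And>s. \<bar>s\<bar> \<le> \<delta> \<Longrightarrow> f s \<le> 2 * s\<^sup>2"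
    "continuous_on UNIV f"
proof -
  have "f2k field_differentiable at x" for x
    using assms(1,3) unfolding C_times_def by (metis funpow_0 mult_is_0 not_gr_zero not_one_le_zero zero_neq_numeral)
  then have cont: "isCont f2k x" for x
    using field_differentiable_imp_continuous_at by blast
  \<comment> \<open>The limit hypothesis is blind to the value at \<open>0\<close>. It makes
    \<open>f2k\<close> tend to \<open>0\<close> there, and continuity then gives
    \<open>f2k 0 = 0\<close>.\<close>
  have lim: "((\<lambda>s. f2k s / \<bar>s\<bar> ^ (2 * k) * \<bar>s\<bar> ^ (2 * k)) \<longlongrightarrow> 0 * \<bar>0\<bar> ^ (2 * k)) (at 0)"
    by (intro tendsto_intros assms(4))
  have "(f2k \<longlongrightarrow> 0) (at 0)"
    by (rule Lim_transform_eventually[OF lim[unfolded mult_zero_left]])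
      (auto simp: eventually_at_filter)
  then have zero: "f2k 0 = 0"
    using cont[of 0] LIM_unique unfolding isCont_def by blast
  obtain d where d: "d > 0" "\<And>s. s \<noteq> 0 \<Longrightarrow> \<bar>s\<bar> < d \<Longrightarrow> \<bar>f2k s / \<bar>s\<bar> ^ (2 * k)\<bar> < 1 / 2"
    using LIM_D[OF assms(4), of "1 / 2"] by (auto simp: dist_real_def)
  have small: "\<bar>f2k s\<bar> \<le> s ^ (2 * k) / 2" if "\<bar>s\<bar> < d" for s
  proof (cases "s = 0")
    case False
    then have "0 < s ^ (2 * k)" by (simp add: zero_less_power_eq)
    then show ?thesis
      using d(2)[OF False that] by (simp add: abs_divide divide_less_eq power_even_abs)
  qed (simp add: zero)
  show thesis
  \<comment> \<open>\<open>1\<close> serves the comparison of powers, and \<open>d / 2\<close> the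
    strict bound \<open>\<bar>s\<bar> < d\<close>.\<close>
  proof (rule that[of "min 1 (d / 2)"])
    fix s assume s: "\<bar>s\<bar> \<le> min 1 (d / 2)"
    then have "\<bar>s\<bar> < d" using d(1) by auto
    from small[OF this] show "s ^ (2 * k) / 2 \<le> f s"
      using assms(2)[of s] by linarith
    have "\<bar>s\<bar> ^ (2 * k) \<le> \<bar>s\<bar> ^ 2"
      using s assms(1) by (intro power_decreasing) auto
    then have "s ^ (2 * k) \<le> s\<^sup>2" by (simp add: power_even_abs)
    with small[OF \<open>\<bar>s\<bar> < d\<close>] show "f s \<le> 2 * s\<^sup>2"
      using assms(2)[of s] by linarith
  next
    show "continuous_on UNIV f"
      unfolding assms(2)[abs_def] using cont
      by (intro continuous_on_add continuous_intros) (auto intro: continuous_at_imp_continuous_on)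
  qed (use d(1) in auto)
qed

text \<open>The identity times a plateau that is \<open>1\<close> for
  \<open>\<bar>x\<bar> \<le> 1\<close> and \<open>0\<close> for
  \<open>\<bar>x\<bar> \<ge> 2\<close>, made of two mirrored steps.\<close>

lemma smooth_cutoff_identE:
  obtains \<psi> where "\<psi> \<in> smooth" "\<And>x. x \<notin> {-2..2} \<Longrightarrow> \<psi> x = 0" "\<And>x. \<bar>x\<bar> < 1 \<Longrightarrow> deriv \<psi> x = 1"
proof -
  obtain \<theta> where \<theta>: "\<theta> \<in> smooth" "\<And>x. x \<le> 0 \<Longrightarrow> \<theta> x = 0" "\<And>x. x \<ge> 1 \<Longrightarrow> \<theta> x = 1"
    by (rule smooth_stepE) blast
  define \<psi> where "\<psi> x = x * (\<theta> (1 * x + 2) * \<theta> (- 1 * x + 2))" for x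
  show thesis
  proof (rule that[of \<psi>])
    show "\<psi> \<in> smooth"
      unfolding \<psi>_def[abs_def] by (intro smooth.mult smooth.ident smooth.affine \<theta>)
    show "\<psi> x = 0" if "x \<notin> {-2..2}" for x
      using that \<theta>(2)[of "1 * x + 2"] \<theta>(2)[of "- 1 * x + 2"] by (auto simp: \<psi>_def)
    show "deriv \<psi> x = 1" if "\<bar>x\<bar> < 1" for x
    proof -
      have ev: "\<forall>\<^sub>F y in nhds x. \<psi> y = y"
      proof (rule eventually_mono[OF eventually_nhds_in_open[of "{-1<..<1}" x]])
        fix y :: real assume "y \<in> {-1<..<1}"
        then have "\<theta> (1 * y + 2) = 1" "\<theta> (- 1 * y + 2) = 1"
          by (auto intro!: \<theta>(3))
        then show "\<psi> y = y" unfolding \<psi>_def by (metis mult.right_neutral)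
      qed (use that in auto)
      have "(\<psi> has_real_derivative 1) (at x)"
        by (simp add: DERIV_cong_ev[OF refl ev refl])
      then show ?thesis by (rule DERIV_imp_deriv)
    qed
  qed
qed

lemma composition_integrable:
  assumes "v \<in> L2" "continuous_on UNIV f" "AE x in lebesgue. 0 \<le> f (v x) \<and> f (v x) \<le> 2 * (v x)\<^sup>2"
  shows "integrable lebesgue (\<lambda>x. f (v x))" "(LINT x|lebesgue. f (v x)) \<le> 2 * (L2_norm v)\<^sup>2"
proof -
  have v: "v \<in> borel_measurable lebesgue" "integrable lebesgue (\<lambda>x. 2 * (v x)\<^sup>2)"
    using assms(1) by (auto simp: L2_def)
  show i: "integrable lebesgue (\<lambda>x. f (v x))"
  proof (rule Bochner_Integration.integrable_bound[OF v(2)])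
    show "(\<lambda>x. f (v x)) \<in> borel_measurable lebesgue"
      using v(1) borel_measurable_continuous_onI[OF assms(2)] by (rule measurable_compose)
    show "AE x in lebesgue. norm (f (v x)) \<le> norm (2 * (v x)\<^sup>2)"
      using assms(3) by eventually_elim simp
  qed
  have "(LINT x|lebesgue. f (v x)) \<le> (LINT x|lebesgue. 2 * (v x)\<^sup>2)"
    by (rule integral_mono_AE[OF i v(2)]) (use assms(3) in eventually_elim, simp)
  then show "(LINT x|lebesgue. f (v x)) \<le> 2 * (L2_norm v)\<^sup>2"
    by (simp add: L2_norm_power2)
qed

text \<open>Smallness enters through \<open>small\<close>, which keeps the values of
  \<open>u\<close> where \<open>f\<close> is controlled; \<open>norm\<close> supplies dominating
  constants that are uniform in time.\<close>

lemma small_periodic_solution_vanishes: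
  fixes f :: "real \<Rightarrow> real" and u :: "real \<Rightarrow> real \<Rightarrow> real"
  assumes f: "\<And>s. \<bar>s\<bar> \<le> \<delta> \<Longrightarrow> s ^ (2 * k) / 2 \<le> f s" "\<And>s. \<bar>s\<bar> \<le> \<delta> \<Longrightarrow> f s \<le> 2 * s\<^sup>2"
      "continuous_on UNIV f"
    and sol: "strong_solution m r f u"
    and uL: "\<And>t. u t \<in> L2" and norm: "\<And>t. L2_norm (u t) \<le> E"
    and small: "\<And>t. AE x in lebesgue. \<bar>u t x\<bar> \<le> \<delta>"
    and per: "\<omega> > 0" "\<And>t. AE x in lebesgue. u (t + \<omega>) x = u t x"
  shows "AE x in lebesgue. u \<tau> x = 0"
proof -
  obtain \<psi> where \<psi>: "\<psi> \<in> smooth" "\<And>x. x \<notin> {-2..2} \<Longrightarrow> \<psi> x = 0" "\<And>x. \<bar>x\<bar> < 1 \<Longrightarrow> deriv \<psi> x = 1"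
    using smooth_cutoff_identE by blast
  obtain K where K: "K \<ge> 0" "\<And>x. \<bar>deriv \<psi> x\<bar> \<le> K"
    using compact_support_bounded[OF smooth_continuous_on[OF smooth_deriv[OF \<psi>(1)]]
        deriv_zero_outside[of "-2" 2 \<psi>]] \<psi>(2) by metis
  obtain L where L: "L \<ge> 0" "\<And>x. \<bar>(deriv ^^ 3) \<psi> x\<bar> \<le> L"
    using compact_support_bounded[OF smooth_continuous_on[OF smooth_derivs[OF \<psi>(1), of 3]]
        derivs_zero_outside[of "-2" 2 \<psi>]] \<psi>(2) by metis
  \<comment> \<open>The successor keeps the scale at least \<open>1\<close>, so that dividing by it
    is harmless.\<close>
  define N where "N n = real (Suc n)" for n
  have N: "N n \<ge> 1" for n by (simp add: N_def)
  define \<phi> where "\<phi> n x = N n * \<psi> (inverse (N n) * x + 0)" for n x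
  have \<phi>: "\<phi> n \<in> smooth" for n
    unfolding \<phi>_def[abs_def] by (intro smooth.mult smooth.const smooth.affine \<psi>)
  have supp: "\<phi> n x = 0" if "x \<notin> {- (2 * N n)..2 * N n}" for n x
  proof -
    have "inverse (N n) * x \<notin> {-2..2}"
      using that N[of n] by (auto simp: field_simps)
    then show ?thesis using \<psi>(2) by (simp add: \<phi>_def)
  qed
  have \<phi>': "deriv (\<phi> n) x = deriv \<psi> (inverse (N n) * x)" for n x
    using derivs_scaled[OF \<psi>(1), of 1 "N n" "inverse (N n)"] N[of n]
    by (simp add: \<phi>_def[abs_def])
  have \<phi>''': "(deriv ^^ 3) (\<phi> n) x = inverse (N n) ^ 2 * (deriv ^^ 3) \<psi> (inverse (N n) * x)" for n x
    using derivs_scaled[OF \<psi>(1), of 3 "N n" "inverse (N n)"] N[of n]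
    by (simp add: \<phi>_def[abs_def] power2_eq_square power3_eq_cube)
  \<comment> \<open>Height \<open>L / N^2\<close> on a support of length \<open>4 N\<close>, with
    \<open>sqrt(4 N)\<close> estimated by \<open>2 N\<close>. The resulting decay \<open>1/N\<close>
    suffices.\<close>
  have third: "(deriv ^^ 3) (\<phi> n) \<in> L2" "L2_norm ((deriv ^^ 3) (\<phi> n)) \<le> 2 * L * inverse (N n)" for n
  proof -
    have c: "continuous_on UNIV ((deriv ^^ 3) (\<phi> n))"
      by (intro smooth_continuous_on smooth_derivs \<phi>)
    have z: "(deriv ^^ 3) (\<phi> n) x = 0" if "x \<notin> {- (2 * N n)..2 * N n}" for x
      using derivs_zero_outside[OF supp that] .
    have b: "\<bar>(deriv ^^ 3) (\<phi> n) x\<bar> \<le> inverse (N n) ^ 2 * L" for x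
      unfolding \<phi>''' using L(2) by (simp add: abs_mult mult_left_mono)
    have le: "- (2 * N n) \<le> 2 * N n" using N[of n] by simp
    show "(deriv ^^ 3) (\<phi> n) \<in> L2"
      by (rule L2_norm_compact_support(1)[OF c z b le])
    have "L2_norm ((deriv ^^ 3) (\<phi> n)) \<le> inverse (N n) ^ 2 * L * sqrt (2 * N n - - (2 * N n))"
      by (rule L2_norm_compact_support(2)[OF c z b le])
    also have "\<dots> \<le> inverse (N n) ^ 2 * L * (2 * N n)"
    proof (rule mult_left_mono)
      have "N n * 1 \<le> N n * N n" using N[of n] by (intro mult_left_mono) auto
      then show "sqrt (2 * N n - - (2 * N n)) \<le> 2 * N n"
        using N[of n] by (intro real_le_lsqrt) (auto simp: power2_eq_square)
    qed (use L(1) in simp)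
    also have "\<dots> = 2 * L * inverse (N n)"
      using N[of n] by (simp add: power2_eq_square field_simps)
    finally show "L2_norm ((deriv ^^ 3) (\<phi> n)) \<le> 2 * L * inverse (N n)" .
  qed
  have fpos: "AE x in lebesgue. (u t x) ^ (2 * k) / 2 \<le> f (u t x) \<and> 0 \<le> f (u t x) \<and> f (u t x) \<le> 2 * (u t x)\<^sup>2" for t
    using small[of t]
  proof eventually_elim
    case (elim x)
    moreover have "0 \<le> (u t x) ^ (2 * k) / 2" by (simp add: zero_le_even_power)
    ultimately show ?case using f(1,2)[of "u t x"] by linarith
  qed
  have fu: "AE x in lebesgue. 0 \<le> f (u t x) \<and> f (u t x) \<le> 2 * (u t x)\<^sup>2" for t
    by (rule eventually_mono[OF fpos[of t]]) simp
  note fint = composition_integrable[OF uL f(3) fu]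
  define F where "F t = (LINT x|lebesgue. f (u t x))" for t
  define A where "A n t = (LINT x|lebesgue. u t x * (deriv ^^ 3) (\<phi> n) x)" for n t
  define B where "B n t = (LINT x|lebesgue. f (u t x) * deriv (\<phi> n) x)" for n t
  have E: "E \<ge> 0" using norm[of 0] L2_norm_nonneg[of "u 0"] by linarith
  have F0: "0 \<le> F t" for t
    unfolding F_def by (rule integral_nonneg_AE) (use fu in \<open>auto elim: eventually_mono\<close>)
  have FE: "F t \<le> 2 * E\<^sup>2" for t
    using fint(2)[of t] power_mono[OF norm L2_norm_nonneg, of t 2] by (simp add: F_def)
  have Ab: "\<bar>A n t\<bar> \<le> E * (2 * L * inverse (N n))" for n t
    unfolding A_def
    by (rule order_trans[OF L2_Cauchy_Schwarz[OF uL third(1)]])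
      (intro mult_mono norm third(2) E L2_norm_nonneg)
  have Ab': "\<bar>A n t\<bar> \<le> E * (2 * L)" for n t
  proof -
    have "2 * L * inverse (N n) \<le> 2 * L"
      using L(1) N[of n] by (intro mult_left_le) (auto simp: field_simps)
    then show ?thesis using Ab[of n t] mult_left_mono[OF _ E] by fastforce
  qed
  have Bm: "(\<lambda>x. f (u t x) * deriv (\<phi> n) x) \<in> borel_measurable lebesgue" for n t
    by (intro borel_measurable_times borel_measurable_integrable fint continuous_imp_lebesgue_measurable
        smooth_continuous_on smooth_deriv \<phi>)
  have Ble: "AE x in lebesgue. norm (f (u t x) * deriv (\<phi> n) x) \<le> K * f (u t x)" for n t
    using fu[of t]
    by eventually_elim (use K in \<open>simp add: \<phi>' abs_mult mult.commute[of K] mult_left_mono\<close>)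
  have Bb: "\<bar>B n t\<bar> \<le> K * (2 * E\<^sup>2)" for n t
  proof -
    have Kf: "integrable lebesgue (\<lambda>x. K * f (u t x))"
      by (intro integrable_mult_right fint)
    have "integrable lebesgue (\<lambda>x. f (u t x) * deriv (\<phi> n) x)"
      by (rule Bochner_Integration.integrable_bound[OF Kf Bm])
        (rule eventually_mono[OF Ble[of t n]], simp)
    then have "norm (B n t) \<le> (LINT x|lebesgue. K * f (u t x))"
      unfolding B_def
      by (intro order_trans[OF integral_norm_bound] integral_mono_AE integrable_norm Kf Ble)
    then have "\<bar>B n t\<bar> \<le> (LINT x|lebesgue. K * f (u t x))" by simp
    also have "\<dots> = K * F t" by (simp add: F_def)
    finally show ?thesis using mult_left_mono[OF FE K(1)] order_trans by blast
  qed
  have Alim: "(\<lambda>n. A n t) \<longlonglongrightarrow> 0" for t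
  proof (rule Lim_null_comparison)
    show "\<forall>\<^sub>F n in sequentially. norm (A n t) \<le> E * (2 * L * inverse (N n))"
      using Ab by (simp add: always_eventually)
    show "(\<lambda>n. E * (2 * L * inverse (N n))) \<longlonglongrightarrow> 0"
      unfolding N_def using LIMSEQ_inverse_real_of_nat by (intro tendsto_mult_right_zero)
  qed
  have Blim: "(\<lambda>n. B n t) \<longlonglongrightarrow> F t" for t
    unfolding B_def F_def
  proof (rule integral_dominated_convergence)
    show "(\<lambda>x. f (u t x)) \<in> borel_measurable lebesgue"
      by (intro borel_measurable_integrable fint)
    show "(\<lambda>x. f (u t x) * deriv (\<phi> n) x) \<in> borel_measurable lebesgue" for n
      by (rule Bm)
    show "integrable lebesgue (\<lambda>x. K * f (u t x))"
      by (intro integrable_mult_right fint)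
    show "AE x in lebesgue. norm (f (u t x) * deriv (\<phi> n) x) \<le> K * f (u t x)" for n
      by (rule Ble)
    show "AE x in lebesgue. (\<lambda>n. f (u t x) * deriv (\<phi> n) x) \<longlonglongrightarrow> f (u t x)"
    proof (intro AE_I2 tendsto_eventually)
      fix x :: real
      show "\<forall>\<^sub>F n in sequentially. f (u t x) * deriv (\<phi> n) x = f (u t x)"
        using eventually_ge_at_top[of "nat \<lceil>\<bar>x\<bar>\<rceil>"]
      proof eventually_elim
        case (elim n)
        then have "\<bar>x\<bar> < N n" unfolding N_def by linarith
        then have "\<bar>inverse (N n) * x\<bar> < 1"
          using N[of n] by (simp add: abs_mult field_simps)
        then show ?case by (simp add: \<phi>' \<psi>(3))
      qed
    qed
  qed
  have FTC: "((\<lambda>t. A n t + B n t) has_integral 0) {s..s + \<omega>}" for n s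
  proof -
    have "((\<lambda>t. A n t + B n t) has_integral
        (LINT x|lebesgue. u (s + \<omega>) x * \<phi> n x) - (LINT x|lebesgue. u s x * \<phi> n x)) {s..s + \<omega>}"
    proof (rule fundamental_theorem_of_calculus)
      show "((\<lambda>t. LINT x|lebesgue. u t x * \<phi> n x) has_vector_derivative A n t + B n t)
          (at t within {s..s + \<omega>})" for t
        unfolding A_def B_def has_real_derivative_iff_has_vector_derivative[symmetric]
        by (rule has_field_derivative_at_within, rule strong_solution_pairing[OF sol \<phi> supp])
    qed (use per(1) in simp)
    moreover have "(LINT x|lebesgue. u (s + \<omega>) x * \<phi> n x) = (LINT x|lebesgue. u s x * \<phi> n x)"
    proof (rule integral_cong_AE)
      have "(\<lambda>x. u t x * \<phi> n x) \<in> borel_measurable lebesgue" for t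
        by (intro borel_measurable_integrable
            locally_integrable_mult[OF L2_imp_locally_integrable[OF uL] smooth_continuous_on[OF \<phi>] supp])
      then show "(\<lambda>x. u (s + \<omega>) x * \<phi> n x) \<in> borel_measurable lebesgue"
        "(\<lambda>x. u s x * \<phi> n x) \<in> borel_measurable lebesgue" by blast+
      show "AE x in lebesgue. u (s + \<omega>) x * \<phi> n x = u s x * \<phi> n x"
        using per(2)[of s] by eventually_elim simp
    qed
    ultimately show ?thesis by simp
  qed
  have Fint: "F integrable_on {s..s + \<omega>}" "integral {s..s + \<omega>} F = 0" for s
  proof -
    have *: "(\<lambda>t. A n t + B n t) integrable_on {s..s + \<omega>}" for n
      using FTC by blast
    have bd: "norm (A n t + B n t) \<le> E * (2 * L) + K * (2 * E\<^sup>2)" for n t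
      using Ab'[of n t] Bb[of n t] by simp
    have cv: "(\<lambda>n. A n t + B n t) \<longlonglongrightarrow> F t" for t
      using tendsto_add[OF Alim Blim] by simp
    show "F integrable_on {s..s + \<omega>}"
      by (rule dominated_convergence(1)[OF * integrable_const_ivl bd cv])
    have "(\<lambda>n. integral {s..s + \<omega>} (\<lambda>t. A n t + B n t)) \<longlonglongrightarrow> integral {s..s + \<omega>} F"
      by (rule dominated_convergence(2)[OF * integrable_const_ivl bd cv])
    moreover have "integral {s..s + \<omega>} (\<lambda>t. A n t + B n t) = 0" for n
      using FTC by (rule integral_unique)
    ultimately show "integral {s..s + \<omega>} F = 0"
      using LIMSEQ_unique[OF tendsto_const] by fastforce
  qed
  have F_AE: "AE t in lebesgue. t \<in> {s..s + \<omega>} \<longrightarrow> F t = 0" for s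
  proof -
    have abs: "F absolutely_integrable_on {s..s + \<omega>}"
      by (rule nonnegative_absolutely_integrable_1[OF Fint(1)]) (rule F0)
    then have "(LINT t|lebesgue. indicator {s..s + \<omega>} t *\<^sub>R F t) = 0"
      using set_lebesgue_integral_eq_integral(2)[OF abs] Fint(2)
      by (simp add: set_lebesgue_integral_def)
    then have "AE t in lebesgue. indicator {s..s + \<omega>} t *\<^sub>R F t = 0"
      using abs F0 by (subst (asm) integral_nonneg_eq_0_iff_AE) (auto simp: set_integrable_def)
    then show ?thesis by (rule eventually_mono) (auto simp: indicator_def)
  qed
  have vanish: "AE x in lebesgue. u t x = 0" if "F t = 0" for t
  proof -
    have "AE x in lebesgue. f (u t x) = 0"
      using that integral_nonneg_eq_0_iff_AE[OF fint(1)] fu[of t]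
      by (auto simp: F_def elim: eventually_mono)
    with fpos[of t] show ?thesis
    proof eventually_elim
      case (elim x)
      then have "(u t x) ^ (2 * k) \<le> 0" by simp
      then show ?case by (simp add: power_le_zero_eq)
    qed
  qed
  show ?thesis
  proof (rule AE_zero_of_smooth_integrals[OF L2_imp_locally_integrable[OF uL]])
    fix \<rho> :: "real \<Rightarrow> real" and a b :: real
    assume \<rho>: "\<rho> \<in> smooth" "\<And>x. x \<notin> {a..b} \<Longrightarrow> \<rho> x = 0"
    define g where "g t = (LINT x|lebesgue. u t x * \<rho> x)" for t
    have "continuous_on UNIV g"
      unfolding g_def using strong_solution_pairing[OF sol \<rho>]
      by (meson DERIV_isCont continuous_at_imp_continuous_on)
    then have "open {t. g t \<noteq> 0}"
      by (intro open_Collect_neq continuous_on_const)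
    then have op: "open ({t. g t \<noteq> 0} \<inter> {\<tau> - \<omega> / 2<..<\<tau> + \<omega> / 2})"
      by auto
    have g0: "g t = 0" if "F t = 0" for t
      unfolding g_def
      by (rule integral_eq_zero_AE) (use vanish[OF that] in \<open>auto elim: eventually_mono\<close>)
    obtain Z where Z: "Z \<in> null_sets lebesgue"
        "{t \<in> space lebesgue. \<not> (t \<in> {\<tau> - \<omega> / 2..\<tau> - \<omega> / 2 + \<omega>} \<longrightarrow> F t = 0)} \<subseteq> Z"
      using F_AE[of "\<tau> - \<omega> / 2"] unfolding eventually_ae_filter by blast
    have "{t. g t \<noteq> 0} \<inter> {\<tau> - \<omega> / 2<..<\<tau> + \<omega> / 2} \<subseteq> Z"
      using Z(2) g0 by auto
    then have "negligible ({t. g t \<noteq> 0} \<inter> {\<tau> - \<omega> / 2<..<\<tau> + \<omega> / 2})"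
      using Z(1) negligible_subset negligible_iff_null_sets by blast
    then have "{t. g t \<noteq> 0} \<inter> {\<tau> - \<omega> / 2<..<\<tau> + \<omega> / 2} = {}"
      using op open_not_negligible by blast
    then have "g \<tau> = 0" using per(1) by auto
    then show "(LINT x|lebesgue. u \<tau> x * \<rho> x) = 0" by (simp add: g_def)
  qed
qed

theorem theorem1p2:
  fixes k :: nat and f f2k :: "real \<Rightarrow> real"
  assumes "k \<ge> 1"
    and "\<And>s. f s = s ^ (2 * k) + f2k s"
    and "C_times (2 * k) f2k"
    and "((\<lambda>s. f2k s / \<bar>s\<bar> ^ (2 * k)) \<longlongrightarrow> 0) (at 0)"
  shows "\<exists>\<epsilon>>0. \<forall>u :: real \<Rightarrow> real \<Rightarrow> real.
           u \<in> continuous_curves 4 2 \<inter> Linf_curves 1 \<longrightarrow>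
           \<not> (\<forall>t. AE x in lebesgue. u t x = 0) \<longrightarrow>
           strong_solution 4 2 f u \<longrightarrow>
           (SUP t. ereal (sobolev_norm 1 (u t))) < ereal \<epsilon> \<longrightarrow>
           \<not> (\<exists>\<omega>>0. \<forall>t. AE x in lebesgue. u (t + \<omega>) x = u t x)"
proof -
  obtain \<delta> where \<delta>: "\<delta> > 0" "\<And>s. \<bar>s\<bar> \<le> \<delta> \<Longrightarrow> s ^ (2 * k) / 2 \<le> f s"
    "\<And>s. \<bar>s\<bar> \<le> \<delta> \<Longrightarrow> f s \<le> 2 * s\<^sup>2" "continuous_on UNIV f"
    using nonlinearity_bounds[OF assms] by blast
  obtain C where C: "C > 0" "\<And>v. v \<in> sobolev 1 \<Longrightarrow> AE x in lebesgue. \<bar>v x\<bar> \<le> C * sobolev_norm 1 v"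
    using sobolev_1_sup_bound by blast
  show ?thesis
  proof (intro exI[of _ "\<delta> / C"] conjI allI impI notI)
    show "\<delta> / C > 0" using \<delta>(1) C(1) by simp
    fix u :: "real \<Rightarrow> real \<Rightarrow> real"
    assume u: "u \<in> continuous_curves 4 2 \<inter> Linf_curves 1" and nz: "\<not> (\<forall>t. AE x in lebesgue. u t x = 0)"
      and sol: "strong_solution 4 2 f u" and sup: "(SUP t. ereal (sobolev_norm 1 (u t))) < ereal (\<delta> / C)"
      and "\<exists>\<omega>>0. \<forall>t. AE x in lebesgue. u (t + \<omega>) x = u t x"
    then obtain \<omega> where per: "\<omega> > 0" "\<And>t. AE x in lebesgue. u (t + \<omega>) x = u t x" by blast
    have H1: "u t \<in> sobolev 1" for t using u by (simp add: Linf_curves_def)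
    then have uL: "u t \<in> L2" for t by (simp add: sobolev_def)
    have "ereal (sobolev_norm 1 (u t)) < ereal (\<delta> / C)" for t
      using sup by (rule le_less_trans[rotated]) (rule SUP_upper, simp)
    then have lt: "sobolev_norm 1 (u t) \<le> \<delta> / C" for t by (simp add: less_imp_le)
    have "L2_norm (u t) \<le> \<delta> / C" for t
      using L2_norm_le_sobolev_norm[OF H1] lt order_trans by blast
    moreover have "AE x in lebesgue. \<bar>u t x\<bar> \<le> \<delta>" for t
    proof -
      have "C * sobolev_norm 1 (u t) \<le> \<delta>"
        using lt[of t] C(1) by (simp add: pos_le_divide_eq mult.commute)
      then show ?thesis using C(2)[OF H1, of t] by (auto elim!: eventually_mono)
    qed
    ultimately have "AE x in lebesgue. u t x = 0" for t
      using small_periodic_solution_vanishes[OF \<delta>(2-4) sol uL _ _ per] by blast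
    then show False using nz by blast
  qed
qed

end
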